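(* Let $\alpha,\beta > 0$ with $\alpha\beta \le 1$. Let $g,\gamma \in \mathrm{L}^2(\mathbb{R})$ be such that $\mathcal{T}_{g;\alpha,\beta}$ and $\mathcal{T}_{\gamma;\alpha,\beta}$ are bounded. Then $\gamma$ is a dual window for $g$ if and only if $$\langle M_{m/\beta} T_{n/\alpha}\gamma, g\rangle = \alpha\beta\, \delta_{m,0}\,\delta_{n,0} \qquad \text{for all } m,n\in\mathbb{Z}.$$
   Context: On $\mathrm{L}^2(\mathbb{R})$ (inner product linear in the first argument), $T_x f = f(\cdot - x)$ and $M_\omega f = e^{2\pi i\omega\,\cdot} f$. For $f \in \mathrm{L}^2(\mathbb{R})$ the coefficient map is $\mathcal{T}_{f;\alpha,\beta} : h \mapsto (\langle h, M_{\alpha m}T_{\beta n} f\rangle)_{m,n\in\mathbb{Z}}$; bounded means it is a (well-defined) bounded map $\mathrm{L}^2(\mathbb{R}) \to \ell^2(\mathbb{Z}^2)$. The vector $f$ generates a Weyl–Heisenberg frame if $\{M_{\alpha m}T_{\beta n}f : m,n\in\mathbb{Z}\}$ is a frame of $\mathrm{L}^2(\mathbb{R})$, i.e. $\mathcal{T}_{f;\alpha,\beta}$ is a topological embedding $\mathrm{L}^2(\mathbb{R}) \hookrightarrow \ell^2(\mathbb{Z}^2)$. A dual window of $f$ is a vector $g \in \mathrm{L}^2(\mathbb{R})$ which generates a Weyl–Heisenberg frame (with the same $\alpha,\beta$) and satisfies $\mathcal{T}_{g;\alpha,\beta}^*\mathcal{T}_{f;\alpha,\beta} = \mathrm{Id}$.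 $\delta$ is the Kronecker delta. *)

theory Defs
  imports "HOL-Analysis.Analysis"
begin

text \<open>
  Elements of the Hilbert space $L^2$ of the real line are represented by Borel measurable
  square-integrable functions (every Lebesgue class contains one). Equality of elements is
  equality almost everywhere.
\<close>

definition L2 :: "(real \<Rightarrow> complex) set" where
  "L2 = {f \<in> borel_measurable lborel. integrable lborel (\<lambda>x. (cmod (f x))\<^sup>2)}"

definition L2_inner :: "(real \<Rightarrow> complex) \<Rightarrow> (real \<Rightarrow> complex) \<Rightarrow> complex" where
  "L2_inner f g = (LINT x|lborel. f x * cnj (g x))"

definition L2_norm :: "(real \<Rightarrow> complex) \<Rightarrow> real" where
  "L2_norm f = sqrt (LINT x|lborel. (cmod (f x))\<^sup>2)"

definition ell2 :: "('i \<Rightarrow> complex) set" where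
  "ell2 = {c. (\<lambda>i. (cmod (c i))\<^sup>2) summable_on UNIV}"

definition ell2_inner :: "('i \<Rightarrow> complex) \<Rightarrow> ('i \<Rightarrow> complex) \<Rightarrow> complex" where
  "ell2_inner c d = (\<Sum>\<^sub>\<infinity>i. c i * cnj (d i))"

definition ell2_norm :: "('i \<Rightarrow> complex) \<Rightarrow> real" where
  "ell2_norm c = sqrt (\<Sum>\<^sub>\<infinity>i. (cmod (c i))\<^sup>2)"

definition bounded_L2_ell2 :: "((real \<Rightarrow> complex) \<Rightarrow> ('i \<Rightarrow> complex)) \<Rightarrow> bool" where
  "bounded_L2_ell2 T \<longleftrightarrow>
     (\<exists>C. \<forall>h\<in>L2. T h \<in> ell2 \<and> ell2_norm (T h) \<le> C * L2_norm h)"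

text \<open>
  The Hilbert space adjoint of a bounded linear operator from $L^2$ to $\ell^2$. For such an
  operator and square-summable \<open>c\<close>, the Riesz representation theorem gives existence of \<open>u\<close>;
  \<open>u\<close> is unique up to equality almost everywhere, so the choice only picks a representative.
\<close>

definition L2_adjoint ::
  "((real \<Rightarrow> complex) \<Rightarrow> ('i \<Rightarrow> complex)) \<Rightarrow> ('i \<Rightarrow> complex) \<Rightarrow> (real \<Rightarrow> complex)" where
  "L2_adjoint T c = (SOME u. u \<in> L2 \<and> (\<forall>h\<in>L2. L2_inner h u = ell2_inner (T h) c))"

definition L2_frame :: "('i \<Rightarrow> real \<Rightarrow> complex) \<Rightarrow> bool" where
  "L2_frame e \<longleftrightarrow>
     (\<forall>i. e i \<in> L2) \<and>
     (\<exists>A B. 0 < A \<and>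
        (\<forall>h\<in>L2. (\<lambda>i. (cmod (L2_inner h (e i)))\<^sup>2) summable_on UNIV \<and>
           A * (L2_norm h)\<^sup>2 \<le> (\<Sum>\<^sub>\<infinity>i. (cmod (L2_inner h (e i)))\<^sup>2) \<and>
           (\<Sum>\<^sub>\<infinity>i. (cmod (L2_inner h (e i)))\<^sup>2) \<le> B * (L2_norm h)\<^sup>2))"

definition translation :: "real \<Rightarrow> (real \<Rightarrow> complex) \<Rightarrow> real \<Rightarrow> complex" where
  "translation x f = (\<lambda>t. f (t - x))"

definition modulation :: "real \<Rightarrow> (real \<Rightarrow> complex) \<Rightarrow> real \<Rightarrow> complex" where
  "modulation \<omega> f = (\<lambda>t. exp (2 * of_real pi * \<i> * of_real \<omega> * of_real t) * f t)"

definition WH_system :: "real \<Rightarrow> real \<Rightarrow> (real \<Rightarrow> complex) \<Rightarrow> int \<times> int \<Rightarrow> real \<Rightarrow> complex" where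
  "WH_system \<alpha> \<beta> f =
     (\<lambda>(m, n). modulation (\<alpha> * of_int m) (translation (\<beta> * of_int n) f))"

definition coeff_map ::
  "real \<Rightarrow> real \<Rightarrow> (real \<Rightarrow> complex) \<Rightarrow> (real \<Rightarrow> complex) \<Rightarrow> int \<times> int \<Rightarrow> complex" where
  "coeff_map \<alpha> \<beta> f h = (\<lambda>p. L2_inner h (WH_system \<alpha> \<beta> f p))"

definition generates_WH_frame :: "real \<Rightarrow> real \<Rightarrow> (real \<Rightarrow> complex) \<Rightarrow> bool" where
  "generates_WH_frame \<alpha> \<beta> f \<longleftrightarrow> L2_frame (WH_system \<alpha> \<beta> f)"

text \<open>\<open>dual_window \<alpha> \<beta> f g\<close>: the function \<open>g\<close> is a dual window of \<open>f\<close>.\<close>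

definition dual_window ::
  "real \<Rightarrow> real \<Rightarrow> (real \<Rightarrow> complex) \<Rightarrow> (real \<Rightarrow> complex) \<Rightarrow> bool" where
  "dual_window \<alpha> \<beta> f g \<longleftrightarrow>
     g \<in> L2 \<and> generates_WH_frame \<alpha> \<beta> g \<and>
     (\<forall>h\<in>L2. AE x in lborel. L2_adjoint (coeff_map \<alpha> \<beta> g) (coeff_map \<alpha> \<beta> f h) x = h x)"

end

theory Submission
  imports Defs
begin

text \<open>
  Duality of \<open>g\<close> and \<open>\<gamma>\<close> means that \<open>\<langle>h, k\<rangle>\<close> equals the sum over all \<open>m\<close> and \<open>n\<close> of
  \<open>\<langle>h, M\<^bsub>\<alpha>m\<^esub>T\<^bsub>\<beta>n\<^esub>g\<rangle>\<close> times the conjugate of \<open>\<langle>k, M\<^bsub>\<alpha>m\<^esub>T\<^bsub>\<beta>n\<^esub>\<gamma>\<rangle>\<close>, for all \<open>h\<close> and \<open>k\<close>. This double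
  sum becomes explicit on localised functions. Let \<open>h\<close> live on a cell of length \<open>1 / \<alpha>\<close> and \<open>k\<close>
  on that cell shifted by \<open>- j / \<alpha>\<close>. For fixed \<open>n\<close> the coefficients of \<open>h\<close> are the Fourier
  coefficients, with period \<open>1 / \<alpha>\<close>, of \<open>h\<close> times the conjugate of \<open>g(\<cdot> - \<beta>n)\<close>; those of \<open>k\<close> have
  the same form after a translation by \<open>j / \<alpha>\<close>, which is invisible to the modulations. Parseval's
  identity carries out the sum over \<open>m\<close> (lemma \<open>coeff_map_cell_pairing\<close>), and the sum over \<open>n\<close>
  leaves \<open>1 / \<alpha>\<close> times the integral of \<open>h(x) \<cdot> cnj (k(x - j/\<alpha>)) \<cdot> \<Phi>\<^sub>j(x)\<close>, where
  \<open>\<Phi>\<^sub>j(x) = \<Sum>\<^sub>n \<gamma>(x - \<beta>n - j/\<alpha>) cnj (g(x - \<beta>n))\<close>. Hence duality says that \<open>\<Phi>\<^sub>j\<close> is the constant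
  \<open>\<alpha>\<close> for \<open>j = 0\<close> and vanishes for \<open>j \<noteq> 0\<close>. On the other hand \<open>\<Phi>\<^sub>j\<close> is the
  \<open>\<beta>\<close>-periodisation of an integrable function, and its Fourier coefficients are, up to the factor
  \<open>1 / \<beta>\<close>, the inner products \<open>\<langle>M\<^bsub>m/\<beta>\<^esub>T\<^bsub>j/\<alpha>\<^esub>\<gamma>, g\<rangle>\<close>. Biorthogonality therefore says the same thing.

  Duality implies biorthogonality by testing with a single exponential on \<open>[0, \<beta>)\<close>; since
  \<open>\<alpha>\<beta> \<le> 1\<close>, this interval fits into a cell of length \<open>1 / \<alpha>\<close>
  (\<open>reproducing_imp_biorthogonal\<close>). Conversely, uniqueness of Fourier coefficients for integrable
  functions determines \<open>\<Phi>\<^sub>j\<close> (\<open>biorthogonal_fibre\<close>) and yields the identity for functions on cells.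
  To pass to arbitrary \<open>h\<close> and \<open>k\<close>, one freezes one argument: as the coefficient maps are
  bounded, the double sum is then the inner product of the other argument with a square
  integrable function, up to complex conjugation (\<open>synthesis_exists\<close>), and a square integrable function is determined by its inner products with
  bounded functions on cells (\<open>L2_eq_AE_on_cells\<close>). The frame inequalities for \<open>\<gamma>\<close> then follow from
  the Cauchy-Schwarz inequality (\<open>reproducing_imp_frame\<close>).

  The Fourier analysis rests on two facts established on the way: rapidly converging partial sums
  have a limit in \<open>L\<^sup>2\<close>, and an integrable function on one period whose Fourier coefficients
  all vanish is zero almost everywhere. The latter is deduced from the Stone-Weierstrass theorem on the
  unit circle. Completeness of the exponentials and Parseval's identity are consequences.
\<close>

section \<open>Square integrable functions\<close>

lemma L2_measurable: "f \<in> L2 \<Longrightarrow> f \<in> borel_measurable lborel"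
  by (simp add: L2_def)

lemma L2_borel_measurable: "f \<in> L2 \<Longrightarrow> f \<in> borel_measurable borel"
  by (simp add: L2_def)

lemma cnj_borel_measurable [measurable]: "cnj \<in> borel_measurable borel"
  by (intro borel_measurable_continuous_onI continuous_intros)

lemma L2_square_integrable: "f \<in> L2 \<Longrightarrow> integrable lborel (\<lambda>x. (cmod (f x))\<^sup>2)"
  by (simp add: L2_def)

lemma L2I:
  assumes "f \<in> borel_measurable lborel" "integrable lborel (\<lambda>x. (cmod (f x))\<^sup>2)"
  shows "f \<in> L2"
  using assms by (simp add: L2_def)

lemma L2_dominated:
  assumes "f \<in> borel_measurable lborel" "integrable lborel w"
    and "\<And>x. (cmod (f x))\<^sup>2 \<le> w x"
  shows "f \<in> L2"
proof (rule L2I)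
  have "0 \<le> w x" for x
    using order_trans[OF zero_le_power2 assms(3)] .
  then show "integrable lborel (\<lambda>x. (cmod (f x))\<^sup>2)"
    using assms by (intro Bochner_Integration.integrable_bound[OF assms(2)]) auto
qed fact

lemma L2_mult_integrable:
  assumes "f \<in> L2" "g \<in> L2"
  shows "integrable lborel (\<lambda>x. f x * cnj (g x))"
proof (rule Bochner_Integration.integrable_bound)
  show "integrable lborel (\<lambda>x. (cmod (f x))\<^sup>2 + (cmod (g x))\<^sup>2)"
    using assms by (intro Bochner_Integration.integrable_add L2_square_integrable)
  show "(\<lambda>x. f x * cnj (g x)) \<in> borel_measurable lborel"
    using assms[THEN L2_measurable] by measurable
  have "cmod (f x * cnj (g x)) \<le> (cmod (f x))\<^sup>2 + (cmod (g x))\<^sup>2" for x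
  proof -
    have "2 * (cmod (f x) * cmod (g x)) \<le> (cmod (f x))\<^sup>2 + (cmod (g x))\<^sup>2"
      using sum_squares_bound[of "cmod (f x)" "cmod (g x)"] by (simp add: mult.assoc)
    then show ?thesis
      using mult_nonneg_nonneg[OF norm_ge_zero[of "f x"] norm_ge_zero[of "g x"]]
      unfolding norm_mult complex_mod_cnj by linarith
  qed
  then show "AE x in lborel. cmod (f x * cnj (g x)) \<le> norm ((cmod (f x))\<^sup>2 + (cmod (g x))\<^sup>2)"
    by auto
qed

lemma L2_scale: "f \<in> L2 \<Longrightarrow> (\<lambda>x. c * f x) \<in> L2"
  using L2_borel_measurable[of f] L2_square_integrable[of f]
  by (intro L2_dominated[where w = "\<lambda>x. (cmod c)\<^sup>2 * (cmod (f x))\<^sup>2"])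
     (auto simp: norm_mult power_mult_distrib)

lemma L2_add:
  assumes "f \<in> L2" "g \<in> L2"
  shows "(\<lambda>x. f x + g x) \<in> L2"
proof (rule L2_dominated)
  show "integrable lborel (\<lambda>x. 2 * (cmod (f x))\<^sup>2 + 2 * (cmod (g x))\<^sup>2)"
    using assms by (simp add: L2_square_integrable)
  show "(\<lambda>x. f x + g x) \<in> borel_measurable lborel"
    using assms[THEN L2_measurable] by measurable
  show "(cmod (f x + g x))\<^sup>2 \<le> 2 * (cmod (f x))\<^sup>2 + 2 * (cmod (g x))\<^sup>2" for x
  proof -
    have "(cmod (f x + g x))\<^sup>2 \<le> (cmod (f x) + cmod (g x))\<^sup>2"
      by (intro power_mono norm_triangle_ineq) simp
    also have "\<dots> \<le> 2 * (cmod (f x))\<^sup>2 + 2 * (cmod (g x))\<^sup>2"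
      using sum_squares_bound[of "cmod (f x)" "cmod (g x)"] by (simp add: power2_sum)
    finally show ?thesis .
  qed
qed

lemma L2_diff: "f \<in> L2 \<Longrightarrow> g \<in> L2 \<Longrightarrow> (\<lambda>x. f x - g x) \<in> L2"
  using L2_add[of f "\<lambda>x. (-1) * g x"] L2_scale[of g "-1"] by simp

lemma L2_zero: "(\<lambda>x. 0) \<in> L2"
  by (rule L2I) auto

lemma L2_sum:
  "finite F \<Longrightarrow> (\<And>i. i \<in> F \<Longrightarrow> f i \<in> L2) \<Longrightarrow> (\<lambda>x. \<Sum>i\<in>F. f i x) \<in> L2"
  by (induction F rule: finite_induct) (auto simp: L2_zero intro: L2_add)

lemma L2_mult_bounded:
  assumes f: "f \<in> L2" and w: "w \<in> borel_measurable lborel" and M: "\<And>x. cmod (w x) \<le> M"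
  shows "(\<lambda>x. w x * f x) \<in> L2"
proof (rule L2_dominated)
  show "integrable lborel (\<lambda>x. M\<^sup>2 * (cmod (f x))\<^sup>2)"
    using f by (simp add: L2_square_integrable)
  show "(\<lambda>x. w x * f x) \<in> borel_measurable lborel"
    using w f[THEN L2_measurable] by measurable
  show "(cmod (w x * f x))\<^sup>2 \<le> M\<^sup>2 * (cmod (f x))\<^sup>2" for x
    using M[of x] by (auto simp: norm_mult power_mult_distrib intro!: mult_right_mono power_mono)
qed

lemma L2_cnj: "f \<in> L2 \<Longrightarrow> (\<lambda>x. cnj (f x)) \<in> L2"
  by (auto simp: L2_def intro: measurable_compose[OF _ cnj_borel_measurable])

lemma L2_bounded_support:
  assumes w: "w \<in> borel_measurable lborel" and M: "\<And>x. cmod (w x) \<le> M"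
    and supp: "\<And>x. x \<notin> {a..<b} \<Longrightarrow> w x = 0"
  shows "w \<in> L2"
proof -
  have "integrable lborel (indicat_real {a..<b})"
    by (cases "a \<le> b") (auto intro!: integrable_real_indicator)
  then have "(\<lambda>x. indicator {a..<b} x) \<in> L2"
    by (intro L2_dominated[where w = "indicat_real {a..<b}"])
       (auto simp: indicator_def less_top)
  then have "(\<lambda>x. w x * indicator {a..<b} x) \<in> L2"
    by (rule L2_mult_bounded[OF _ w M])
  moreover have "(\<lambda>x. w x * indicator {a..<b} x) = w"
    using supp by (auto simp: fun_eq_iff indicator_def)
  ultimately show ?thesis by simp
qed

lemma L2_shift:
  assumes f: "f \<in> L2"
  shows "(\<lambda>x. f (x - t)) \<in> L2"
proof (rule L2I)
  show "(\<lambda>x. f (x - t)) \<in> borel_measurable lborel"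
    using f[THEN L2_borel_measurable] by simp
  show "integrable lborel (\<lambda>x. (cmod (f (x - t)))\<^sup>2)"
    using lborel_integrable_real_affine[OF L2_square_integrable[OF f], of 1 "- t"] by simp
qed

lemma L2_norm_nonneg: "0 \<le> L2_norm f"
  by (simp add: L2_norm_def)

lemma L2_norm_squared: "(L2_norm f)\<^sup>2 = (LINT x|lborel. (cmod (f x))\<^sup>2)"
  by (simp add: L2_norm_def)

lemma L2_inner_self: "L2_inner f f = of_real ((L2_norm f)\<^sup>2)"
  unfolding L2_inner_def L2_norm_squared
  by (simp add: complex_norm_square[symmetric] del: of_real_power)

lemma L2_inner_commute: "L2_inner f g = cnj (L2_inner g f)"
proof -
  have "cnj (LINT x|lborel. g x * cnj (f x)) = (LINT x|lborel. cnj (g x * cnj (f x)))"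
    by (rule Bochner_Integration.integral_cnj[symmetric])
  then show ?thesis
    by (simp add: L2_inner_def mult.commute)
qed

lemma L2_inner_diff_right:
  assumes "h \<in> L2" "f \<in> L2" "g \<in> L2"
  shows "L2_inner h (\<lambda>x. f x - g x) = L2_inner h f - L2_inner h g"
  unfolding L2_inner_def
  using L2_mult_integrable[OF assms(1,2)] L2_mult_integrable[OF assms(1,3)]
  by (simp add: algebra_simps)

lemma L2_inner_scale_right: "L2_inner h (\<lambda>x. c * f x) = cnj c * L2_inner h f"
proof -
  have "L2_inner h (\<lambda>x. c * f x) = (LINT x|lborel. cnj c * (h x * cnj (f x)))"
    by (simp add: L2_inner_def algebra_simps)
  then show ?thesis by (simp add: L2_inner_def)
qed

lemma L2_inner_sum_right:
  assumes "finite F" "\<And>i. i \<in> F \<Longrightarrow> f i \<in> L2" "h \<in> L2"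
  shows "L2_inner h (\<lambda>x. \<Sum>i\<in>F. f i x) = (\<Sum>i\<in>F. L2_inner h (f i))"
  unfolding L2_inner_def
  using assms by (simp add: sum_distrib_left L2_mult_integrable)

lemma L2_inner_AE_cong:
  assumes "f \<in> L2" "f' \<in> L2" "h \<in> L2" "AE x in lborel. f x = f' x"
  shows "L2_inner h f = L2_inner h f'"
  unfolding L2_inner_def
proof (rule integral_cong_AE)
  have [measurable]: "f \<in> borel_measurable lborel" "f' \<in> borel_measurable lborel"
      "h \<in> borel_measurable lborel"
    using assms by (auto dest: L2_measurable)
  show "(\<lambda>x. h x * cnj (f x)) \<in> borel_measurable lborel"
    "(\<lambda>x. h x * cnj (f' x)) \<in> borel_measurable lborel"
    by measurable
qed (use assms(4) in auto)

lemma L2_Cauchy_Schwarz: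
  assumes "f \<in> L2" "g \<in> L2"
  shows "cmod (L2_inner f g) \<le> L2_norm f * L2_norm g"
proof -
  have [measurable]: "f \<in> borel_measurable lborel" "g \<in> borel_measurable lborel"
    using assms by (auto dest: L2_measurable)
  let ?I = "LINT x|lborel. cmod (f x) * cmod (g x)"
  have int: "integrable lborel (\<lambda>x. cmod (f x) * cmod (g x))"
    using L2_mult_integrable[OF assms, THEN integrable_norm] by (simp add: norm_mult)
  have nn: "0 \<le> ?I" by simp
  have sq: "(\<integral>\<^sup>+x. (ennreal (cmod (h x)))\<^sup>2 \<partial>lborel) = ennreal ((L2_norm h)\<^sup>2)" if "h \<in> L2" for h
    using nn_integral_eq_integral[OF L2_square_integrable[OF that]]
    by (simp add: L2_norm_squared ennreal_power)
  have "(\<integral>\<^sup>+x. ennreal (cmod (f x)) * ennreal (cmod (g x)) \<partial>lborel)\<^sup>2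
      \<le> (\<integral>\<^sup>+x. (ennreal (cmod (f x)))\<^sup>2 \<partial>lborel) * (\<integral>\<^sup>+x. (ennreal (cmod (g x)))\<^sup>2 \<partial>lborel)"
    by (rule Cauchy_Schwarz_nn_integral) measurable
  also have "\<dots> = ennreal ((L2_norm f)\<^sup>2 * (L2_norm g)\<^sup>2)"
    using assms by (simp add: sq ennreal_mult)
  also have "(\<integral>\<^sup>+x. ennreal (cmod (f x)) * ennreal (cmod (g x)) \<partial>lborel) = ennreal ?I"
    using nn_integral_eq_integral[OF int] by (simp add: ennreal_mult)
  finally have "?I\<^sup>2 \<le> (L2_norm f * L2_norm g)\<^sup>2"
    using nn by (simp add: ennreal_power power_mult_distrib)
  then have "?I \<le> L2_norm f * L2_norm g"
    by (rule power2_le_imp_le) (simp add: L2_norm_nonneg)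
  moreover have "cmod (L2_inner f g) \<le> ?I"
    unfolding L2_inner_def using integral_norm_bound[of lborel "\<lambda>x. f x * cnj (g x)"]
    by (simp add: norm_mult)
  ultimately show ?thesis by linarith
qed

lemma L2_null:
  assumes "f \<in> L2" "L2_inner f f = 0"
  shows "AE x in lborel. f x = 0"
proof -
  have "(LINT x|lborel. (cmod (f x))\<^sup>2) = 0"
    using assms(2) by (simp add: L2_inner_self L2_norm_squared del: of_real_power)
  then show ?thesis
    using integral_nonneg_eq_0_iff_AE[OF L2_square_integrable[OF assms(1)]] by simp
qed

lemma L2_eq_AE_iff_inner:
  assumes u: "u \<in> L2" and v: "v \<in> L2"
  shows "(AE x in lborel. u x = v x) \<longleftrightarrow> (\<forall>h\<in>L2. L2_inner h u = L2_inner h v)"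
proof
  assume "AE x in lborel. u x = v x"
  then show "\<forall>h\<in>L2. L2_inner h u = L2_inner h v"
    using L2_inner_AE_cong[OF u v] by blast
next
  assume eq: "\<forall>h\<in>L2. L2_inner h u = L2_inner h v"
  let ?w = "\<lambda>x. u x - v x"
  have w: "?w \<in> L2" using u v by (rule L2_diff)
  have "L2_inner ?w ?w = 0"
    using eq w by (simp add: L2_inner_diff_right[OF w u v])
  then have "AE x in lborel. ?w x = 0" by (rule L2_null[OF w])
  then show "AE x in lborel. u x = v x" by eventually_elim simp
qed

text \<open>
  This replaces a density argument. If \<open>w = u - v\<close> is orthogonal to all bounded functions living on
  a single cell, it is orthogonal to its own truncation to a cell and to a sublevel set of \<open>|w|\<close>,
  so that truncation vanishes; countably many truncations exhaust \<open>w\<close>.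
\<close>

lemma L2_eq_AE_on_cells:
  fixes C :: "'i :: countable \<Rightarrow> real set"
  assumes u: "u \<in> L2" and v: "v \<in> L2"
    and C: "\<And>i. C i \<in> sets borel" "\<And>x. \<exists>i. x \<in> C i"
    and eq: "\<And>i k M. \<lbrakk>k \<in> borel_measurable lborel; \<And>x. cmod (k x) \<le> M; \<And>x. x \<notin> C i \<Longrightarrow> k x = 0; k \<in> L2\<rbrakk>
      \<Longrightarrow> L2_inner k u = L2_inner k v"
  shows "AE x in lborel. u x = v x"
proof -
  define w where "w x = u x - v x" for x
  have w: "w \<in> L2" unfolding w_def[abs_def] by (rule L2_diff[OF u v])
  have [measurable]: "w \<in> borel_measurable borel" "C i \<in> sets borel" for i
    using L2_borel_measurable[OF w] C by auto
  have "AE x in lborel. \<forall>i. \<forall>N::nat. x \<in> C i \<longrightarrow> cmod (w x) \<le> N \<longrightarrow> w x = 0"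
    unfolding AE_all_countable
  proof (intro allI)
    fix i and N :: nat
    define D where "D = C i \<inter> {x. cmod (w x) \<le> real N}"
    have [measurable]: "D \<in> sets borel" unfolding D_def by measurable
    define k where "k x = indicator D x * w x" for x
    have km: "k \<in> borel_measurable lborel" unfolding k_def[abs_def] by measurable
    have k: "k \<in> L2"
      unfolding k_def[abs_def] by (rule L2_mult_bounded[OF w, where M = 1]) (auto simp: indicator_def)
    have "L2_inner k u = L2_inner k v"
      by (rule eq[where M = "real N" and i = i, OF km _ _ k]) (auto simp: k_def D_def indicator_def)
    then have "L2_inner k w = 0"
      unfolding w_def[abs_def] by (simp add: L2_inner_diff_right[OF k u v])
    moreover have "L2_inner k w = L2_inner k k"
      unfolding L2_inner_def k_def by (intro Bochner_Integration.integral_cong) (auto simp: indicator_def)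
    ultimately have "AE x in lborel. k x = 0"
      using L2_null[OF k] by simp
    then show "AE x in lborel. x \<in> C i \<longrightarrow> cmod (w x) \<le> N \<longrightarrow> w x = 0"
      by eventually_elim (auto simp: k_def D_def)
  qed
  then show ?thesis
  proof eventually_elim
    case (elim x)
    obtain i where "x \<in> C i" using C(2) by blast
    moreover obtain N :: nat where "cmod (w x) \<le> N" using real_arch_simple by blast
    ultimately have "w x = 0" using elim by blast
    then show ?case by (simp add: w_def)
  qed
qed

section \<open>Square summable families\<close>

lemma ell2_mult_abs_summable:
  assumes "c \<in> ell2" "d \<in> ell2"
  shows "(\<lambda>i. cmod (c i * cnj (d i))) summable_on A"
proof -
  have "(\<lambda>i. cmod (c i * cnj (d i))) summable_on UNIV"
    by (rule abs_summable_product)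
       (use assms in \<open>simp_all add: ell2_def norm_mult power2_eq_square\<close>)
  then show ?thesis
    by (rule summable_on_subset_banach) simp
qed

lemma ell2_norm_nonneg: "0 \<le> ell2_norm c"
  by (simp add: ell2_norm_def infsum_nonneg)

lemma ell2_norm_squared: "(ell2_norm c)\<^sup>2 = (\<Sum>\<^sub>\<infinity>i. (cmod (c i))\<^sup>2)"
  by (simp add: ell2_norm_def infsum_nonneg)

lemma ell2_inner_commute: "ell2_inner c d = cnj (ell2_inner d c)"
  by (simp add: ell2_inner_def mult.commute flip: infsum_cnj)

lemma ell2_Cauchy_Schwarz:
  assumes "c \<in> ell2" "d \<in> ell2"
  shows "cmod (ell2_inner c d) \<le> ell2_norm c * ell2_norm d"
proof -
  have abs: "(\<lambda>i. cmod (c i * cnj (d i))) summable_on UNIV"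
    using ell2_mult_abs_summable[OF assms] .
  have "cmod (ell2_inner c d) \<le> (\<Sum>\<^sub>\<infinity>i. cmod (c i * cnj (d i)))"
    unfolding ell2_inner_def by (rule norm_infsum_bound[OF abs])
  also have "\<dots> \<le> ell2_norm c * ell2_norm d"
  proof (rule infsum_le_finite_sums[OF abs])
    fix F :: "'a set" assume F: "finite F"
    have le: "L2_set (\<lambda>i. cmod (e i)) F \<le> ell2_norm e" if "e \<in> ell2" for e
      unfolding L2_set_def ell2_norm_def real_sqrt_le_iff
      using that F by (intro finite_sum_le_infsum) (auto simp: ell2_def)
    have "(\<Sum>i\<in>F. cmod (c i * cnj (d i))) \<le> L2_set (\<lambda>i. cmod (c i)) F * L2_set (\<lambda>i. cmod (d i)) F"
      using L2_set_mult_ineq[of "\<lambda>i. cmod (c i)" "\<lambda>i. cmod (d i)" F] by (simp add: norm_mult)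
    also have "\<dots> \<le> ell2_norm c * ell2_norm d"
      using assms by (intro mult_mono le ell2_norm_nonneg) (auto simp: L2_set_nonneg)
    finally show "(\<Sum>i\<in>F. cmod (c i * cnj (d i))) \<le> ell2_norm c * ell2_norm d" .
  qed
  finally show ?thesis .
qed

text \<open>
  The modulation index is summed first, which is the sum that Parseval's identity evaluates.
\<close>

lemma ell2_inner_iterated:
  fixes c d :: "int \<times> int \<Rightarrow> complex"
  assumes "c \<in> ell2" "d \<in> ell2"
  shows "ell2_inner c d = (\<Sum>\<^sub>\<infinity>n. ell2_inner (\<lambda>m. c (m, n)) (\<lambda>m. d (m, n)))"
proof -
  let ?f = "\<lambda>p. c p * cnj (d p)"
  have sm: "?f summable_on UNIV \<times> UNIV"
    using abs_summable_summable[OF ell2_mult_abs_summable[OF assms]] .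
  have "ell2_inner c d = (\<Sum>\<^sub>\<infinity>m. \<Sum>\<^sub>\<infinity>n. ?f (m, n))"
    using infsum_Sigma_banach[OF sm] by (simp add: ell2_inner_def)
  also have "\<dots> = (\<Sum>\<^sub>\<infinity>n. \<Sum>\<^sub>\<infinity>m. ?f (m, n))"
    using sm by (intro infsum_swap_banach) (simp add: case_prod_unfold)
  finally show ?thesis by (simp add: ell2_inner_def)
qed

lemma ell2_restrict:
  assumes "c \<in> ell2"
  shows "(\<lambda>i. of_bool (i \<in> A) * c i) \<in> ell2"
    and "(ell2_norm (\<lambda>i. of_bool (i \<in> A) * c i))\<^sup>2 = (\<Sum>\<^sub>\<infinity>i\<in>A. (cmod (c i))\<^sup>2)"
proof -
  have "(\<lambda>i. (cmod (c i))\<^sup>2) summable_on A"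
    using assms summable_on_subset_banach[of "\<lambda>i. (cmod (c i))\<^sup>2" UNIV A] by (simp add: ell2_def)
  moreover have "(\<lambda>i. (cmod (of_bool (i \<in> A) * c i))\<^sup>2) summable_on UNIV
      \<longleftrightarrow> (\<lambda>i. (cmod (c i))\<^sup>2) summable_on A"
    by (rule summable_on_cong_neutral) auto
  ultimately show "(\<lambda>i. of_bool (i \<in> A) * c i) \<in> ell2"
    unfolding ell2_def by blast
  show "(ell2_norm (\<lambda>i. of_bool (i \<in> A) * c i))\<^sup>2 = (\<Sum>\<^sub>\<infinity>i\<in>A. (cmod (c i))\<^sup>2)"
    unfolding ell2_norm_squared by (rule infsum_cong_neutral) auto
qed

text \<open>
  Finite index sets along which the mass of the tails decays geometrically. The ratio \<open>1 / 8\<close> is small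
  enough to beat the weights \<open>2 ^ k\<close> of \<open>L2_series_converges\<close>.
\<close>

lemma ell2_tail_exhaustion:
  assumes "c \<in> ell2"
  obtains F K where "\<And>k. finite (F k)" "F 0 = {}" "\<And>k::nat. F k \<subseteq> F (Suc k)" "0 \<le> K"
    "\<And>k. (\<Sum>\<^sub>\<infinity>i\<in>- F k. (cmod (c i))\<^sup>2) \<le> K * (1/8) ^ k"
proof -
  let ?q = "\<lambda>i. (cmod (c i))\<^sup>2"
  define S where "S = (\<Sum>\<^sub>\<infinity>i. ?q i)"
  have sm: "?q summable_on A" for A
    using assms summable_on_subset_banach[of ?q UNIV A] by (simp add: ell2_def)
  have S0: "0 \<le> S" by (simp add: S_def infsum_nonneg)
  have split: "S = sum ?q F + infsum ?q (- F)" if "finite F" for F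
  proof -
    have "infsum ?q (F \<union> - F) = infsum ?q F + infsum ?q (- F)"
      by (rule infsum_Un_disjoint) (auto intro: sm)
    then show ?thesis using that by (simp add: S_def)
  qed
  have "\<exists>G. finite G \<and> infsum ?q (- G) \<le> (1/8) ^ k" for k :: nat
  proof -
    obtain G where "finite G" "dist (sum ?q G) S \<le> (1/8) ^ k"
      using infsum_finite_approximation[OF sm[of UNIV], of "(1/8) ^ k"] by (auto simp: S_def)
    then show ?thesis
      using split[of G] by (intro exI[of _ G]) (auto simp: dist_real_def)
  qed
  then obtain G where G: "\<And>k. finite (G k)" "\<And>k::nat. infsum ?q (- G k) \<le> (1/8) ^ k"
    by metis
  define F where "F k = (\<Union>i<k. G i)" for k
  show ?thesis
  proof (rule that[of F "S + 8"])
    show fin: "finite (F k)" for k by (simp add: F_def G)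
    show "infsum ?q (- F k) \<le> (S + 8) * (1/8) ^ k" for k
    proof (cases k)
      case 0
      then show ?thesis by (simp add: F_def S_def)
    next
      case (Suc n)
      have "infsum ?q (- F k) \<le> infsum ?q (- G n)"
        by (rule infsum_mono2) (auto simp: F_def Suc intro: sm)
      also have "\<dots> \<le> 8 * (1/8) ^ k" using G(2)[of n] by (simp add: Suc)
      also have "\<dots> \<le> (S + 8) * (1/8) ^ k" using S0 by (intro mult_right_mono) auto
      finally show ?thesis .
    qed
  qed (use S0 in \<open>auto simp: F_def intro: less_SucI\<close>)
qed

section \<open>Synthesis from square summable coefficients\<close>

text \<open>
  A form of the completeness of \<open>L\<^sup>2\<close>. The weights \<open>2 ^ k\<close> make the pointwise sum
  \<open>D(x) = \<Sum>\<^sub>k 2 ^ k |v k x|\<^sup>2\<close> integrable, hence finite almost everywhere. By the Cauchy-Schwarz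
  inequality \<open>(\<Sum>\<^sub>k |v k x|)\<^sup>2 \<le> (\<Sum>\<^sub>k 2 ^ -k) D(x) = 2 D(x)\<close>, so the series converges absolutely at such
  \<open>x\<close>, and \<open>2 D\<close> dominates the squared remainders.
\<close>

lemma L2_series_converges:
  assumes v: "\<And>k. v k \<in> L2"
    and sum: "summable (\<lambda>k. 2 ^ k * (L2_norm (v k))\<^sup>2)"
  obtains u where "u \<in> L2" "(\<lambda>n. L2_norm (\<lambda>x. u x - (\<Sum>k<n. v k x))) \<longlonglongrightarrow> 0"
proof -
  have [measurable]: "v k \<in> borel_measurable lborel" for k
    using v by (rule L2_measurable)
  define q where "q k x = 2 ^ k * (cmod (v k x))\<^sup>2" for k x
  have [measurable]: "q k \<in> borel_measurable lborel" for k
    unfolding q_def by measurable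
  have q0: "0 \<le> q k x" for k x
    by (simp add: q_def)
  have qint: "integrable lborel (q k)" for k
    unfolding q_def using L2_square_integrable[OF v] by (intro integrable_mult_right) 
  have qsum: "summable (\<lambda>k. LINT x|lborel. q k x)"
    using sum by (simp add: q_def L2_norm_squared)
  have qAE: "AE x in lborel. summable (\<lambda>k. q k x)"
  proof -
    have "(\<integral>\<^sup>+x. (\<Sum>k. ennreal (q k x)) \<partial>lborel) = (\<Sum>k. \<integral>\<^sup>+x. ennreal (q k x) \<partial>lborel)"
      by (rule nn_integral_suminf) measurable
    also have "\<dots> = (\<Sum>k. ennreal (LINT x|lborel. q k x))"
      using qint q0 by (intro suminf_cong nn_integral_eq_integral) auto
    also have "\<dots> \<noteq> \<infinity>"
      using qsum q0 by (simp add: suminf_ennreal2)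
    finally have "AE x in lborel. (\<Sum>k. ennreal (q k x)) \<noteq> \<infinity>"
      by (intro nn_integral_PInf_AE) measurable
    then show ?thesis
      by eventually_elim (use q0 in \<open>auto intro: summable_suminf_not_top\<close>)
  qed
  define D where "D x = (\<Sum>k. q k x)" for x
  have Dint: "integrable lborel D"
    unfolding D_def using qint qAE qsum q0 by (intro integrable_suminf) auto
  define u where "u x = (\<Sum>k. v k x)" for x
  have [measurable]: "u \<in> borel_measurable lborel"
    unfolding u_def by measurable
  define r where "r n x = u x - (\<Sum>k<n. v k x)" for n x
  have [measurable]: "r n \<in> borel_measurable lborel" for n
    unfolding r_def by measurable
  \<comment> \<open>At a point where the weighted series converges, \<open>|v k x|\<close> is bounded by the summable
     \<open>(1/2) ^ k + q k x\<close>, whichever of \<open>|v k x|\<close> and \<open>(1/2) ^ k\<close> is larger.\<close>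
  have point: "(\<forall>n. (cmod (r n x))\<^sup>2 \<le> 2 * D x) \<and> (\<lambda>n. (cmod (r n x))\<^sup>2) \<longlonglongrightarrow> 0"
    if qs: "summable (\<lambda>k. q k x)" for x
  proof -
    have le: "cmod (v k x) \<le> (1/2) ^ k + q k x" for k
    proof (cases "cmod (v k x) \<le> (1/2) ^ k")
      case False
      have "1 = 2 ^ k * (1/2 :: real) ^ k" by (simp add: power_divide)
      also have "\<dots> \<le> 2 ^ k * cmod (v k x)" using False by simp
      finally have "cmod (v k x) * 1 \<le> cmod (v k x) * (2 ^ k * cmod (v k x))"
        by (intro mult_left_mono) auto
      then have "cmod (v k x) \<le> q k x" by (simp add: q_def power2_eq_square mult_ac)
      then show ?thesis by (simp add: add_increasing)
    qed (simp add: q0 add_increasing2)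
    have vs: "summable (\<lambda>k. cmod (v k x))"
      by (rule summable_comparison_test'[OF summable_add[OF summable_geometric[of "1/2"] qs], of 0])
         (use le in auto)
    define H where "H = (\<Sum>k. cmod (v k x))"
    have "(\<Sum>k<m. cmod (v k x))\<^sup>2 \<le> 2 * D x" for m
    proof -
      have "(\<Sum>k<m. cmod (v k x))\<^sup>2 = (\<Sum>k<m. sqrt ((1/2) ^ k) * sqrt (q k x))\<^sup>2"
        by (simp add: q_def real_sqrt_mult[symmetric] power_divide)
      also have "\<dots> \<le> (\<Sum>k<m. (sqrt ((1/2) ^ k))\<^sup>2) * (\<Sum>k<m. (sqrt (q k x))\<^sup>2)"
        by (rule Cauchy_Schwarz_ineq_sum)
      also have "\<dots> = (\<Sum>k<m. (1/2) ^ k) * (\<Sum>k<m. q k x)"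
        by (simp add: q0)
      also have "\<dots> \<le> (\<Sum>k. (1/2) ^ k) * D x"
        unfolding D_def
        by (intro mult_mono sum_le_suminf qs) (auto simp: q0 sum_nonneg suminf_nonneg summable_geometric)
      finally show ?thesis by (simp add: suminf_geometric)
    qed
    moreover have "(\<lambda>m. (\<Sum>k<m. cmod (v k x))\<^sup>2) \<longlonglongrightarrow> H\<^sup>2"
      unfolding H_def by (intro tendsto_power summable_LIMSEQ vs)
    ultimately have HD: "H\<^sup>2 \<le> 2 * D x"
      by (intro LIMSEQ_le_const2) auto
    have vsum: "summable (\<lambda>k. v k x)"
      using vs by (rule summable_norm_cancel)
    have "cmod (r n x) \<le> H" for n
    proof -
      have "r n x = (\<Sum>k. v (k + n) x)"
        using suminf_split_initial_segment[OF vsum, of n] by (simp add: r_def u_def)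
      also have "cmod \<dots> \<le> (\<Sum>k. cmod (v (k + n) x))"
        by (intro summable_norm) (use vs in \<open>simp add: summable_iff_shift[of "\<lambda>k. cmod (v k x)"]\<close>)
      also have "\<dots> \<le> H"
        using suminf_split_initial_segment[OF vs, of n] by (simp add: H_def sum_nonneg)
      finally show ?thesis .
    qed
    then have "(cmod (r n x))\<^sup>2 \<le> H\<^sup>2" for n
      by (rule power_mono) simp
    moreover have "(\<lambda>n. (cmod (r n x))\<^sup>2) \<longlonglongrightarrow> (cmod (u x - u x))\<^sup>2"
      unfolding r_def u_def by (intro tendsto_intros summable_LIMSEQ vsum)
    ultimately show ?thesis using HD by (simp, meson order_trans)
  qed
  have bound: "AE x in lborel. (cmod (r n x))\<^sup>2 \<le> 2 * D x" for n
    using qAE by eventually_elim (use point in auto)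
  have "r 0 \<in> L2"
  proof (rule L2I)
    show "integrable lborel (\<lambda>x. (cmod (r 0 x))\<^sup>2)"
    proof (rule Bochner_Integration.integrable_bound)
      show "integrable lborel (\<lambda>x. 2 * D x)" using Dint by simp
      show "AE x in lborel. norm ((cmod (r 0 x))\<^sup>2) \<le> norm (2 * D x)"
        using bound[of 0] by eventually_elim simp
    qed measurable
  qed measurable
  moreover have "(\<lambda>n. LINT x|lborel. (cmod (r n x))\<^sup>2) \<longlonglongrightarrow> (LINT x|(lborel :: real measure). (0::real))"
  proof (rule integral_dominated_convergence)
    show "integrable lborel (\<lambda>x. 2 * D x)" using Dint by simp
    show "AE x in lborel. (\<lambda>n. (cmod (r n x))\<^sup>2) \<longlonglongrightarrow> 0"
      using qAE by eventually_elim (use point in auto)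
    show "AE x in lborel. norm ((cmod (r n x))\<^sup>2) \<le> 2 * D x" for n
      using bound[of n] by simp
  qed measurable
  then have "(\<lambda>n. L2_norm (r n)) \<longlonglongrightarrow> 0"
    unfolding L2_norm_def using tendsto_real_sqrt by fastforce
  ultimately show ?thesis
    using that[of u] unfolding r_def[abs_def] by simp
qed

text \<open>
  The bound may be taken positive, so that one can divide by it.
\<close>

lemma bounded_L2_ell2_obtain:
  assumes "bounded_L2_ell2 T"
  obtains C where "0 < C" "\<And>h. h \<in> L2 \<Longrightarrow> T h \<in> ell2"
    "\<And>h. h \<in> L2 \<Longrightarrow> ell2_norm (T h) \<le> C * L2_norm h"
proof -
  obtain C where C: "\<And>h. h \<in> L2 \<Longrightarrow> T h \<in> ell2 \<and> ell2_norm (T h) \<le> C * L2_norm h"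
    using assms unfolding bounded_L2_ell2_def by blast
  have "ell2_norm (T h) \<le> (\<bar>C\<bar> + 1) * L2_norm h" if "h \<in> L2" for h
    using C[OF that] mult_right_mono[of C "\<bar>C\<bar> + 1" "L2_norm h"] L2_norm_nonneg[of h] by force
  then show ?thesis using C by (intro that[of "\<bar>C\<bar> + 1"]) auto
qed

text \<open>
  The adjoint of a bounded coefficient map exists: \<open>u\<close> is the sum of the \<open>c i\<close> times \<open>e i\<close>. Boundedness
  controls finite partial sums by duality: \<open>\<parallel>s\<parallel>\<^sup>2\<close> is the pairing of the coefficients of
  \<open>s\<close> with the finitely many \<open>c i\<close> involved, hence at most \<open>C \<parallel>s\<parallel>\<close> times the norm of these \<open>c i\<close>.
  So the partial sums along a fast exhaustion of \<open>c\<close> converge.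
\<close>

lemma synthesis_exists:
  fixes e :: "'i \<Rightarrow> real \<Rightarrow> complex"
  assumes e: "\<And>i. e i \<in> L2" and bdd: "bounded_L2_ell2 (\<lambda>h i. L2_inner h (e i))"
    and c: "c \<in> ell2"
  obtains u where "u \<in> L2" "\<And>h. h \<in> L2 \<Longrightarrow> L2_inner h u = ell2_inner (\<lambda>i. L2_inner h (e i)) c"
proof -
  let ?T = "\<lambda>h i. L2_inner h (e i)"
  let ?q = "\<lambda>i. (cmod (c i))\<^sup>2"
  let ?r = "\<lambda>A i. of_bool (i \<in> A) * c i"
  obtain C where C: "0 < C" "\<And>h. h \<in> L2 \<Longrightarrow> ?T h \<in> ell2"
      "\<And>h. h \<in> L2 \<Longrightarrow> ell2_norm (?T h) \<le> C * L2_norm h"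
    using bounded_L2_ell2_obtain[OF bdd] by blast
  define s where "s A x = (\<Sum>i\<in>A. c i * e i x)" for A x
  have sL2: "s A \<in> L2" if "finite A" for A
    unfolding s_def[abs_def] using that e by (intro L2_sum L2_scale)
  have inner_s: "L2_inner h (s A) = ell2_inner (?T h) (?r A)" if "finite A" "h \<in> L2" for A h
  proof -
    have "L2_inner h (s A) = (\<Sum>i\<in>A. ?T h i * cnj (c i))"
      unfolding s_def[abs_def] using that e
      by (subst L2_inner_sum_right) (auto simp: L2_scale L2_inner_scale_right mult.commute)
    also have "\<dots> = ell2_inner (?T h) (?r A)"
      unfolding ell2_inner_def infsum_finite[OF that(1), symmetric]
      by (rule infsum_cong_neutral) auto
    finally show ?thesis .
  qed
  have norm_s: "L2_norm (s A) \<le> C * ell2_norm (?r A)" if A: "finite A" for A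
  proof -
    have "L2_norm (s A) * L2_norm (s A) = cmod (L2_inner (s A) (s A))"
      by (simp add: L2_inner_self power2_eq_square L2_norm_nonneg norm_mult)
    also have "\<dots> \<le> ell2_norm (?T (s A)) * ell2_norm (?r A)"
      unfolding inner_s[OF A sL2[OF A]]
      by (intro ell2_Cauchy_Schwarz C sL2 A ell2_restrict c)
    also have "\<dots> \<le> (C * L2_norm (s A)) * ell2_norm (?r A)"
      by (intro mult_right_mono C sL2 A ell2_norm_nonneg)
    finally have "L2_norm (s A) * L2_norm (s A) \<le> L2_norm (s A) * (C * ell2_norm (?r A))"
      by (simp add: mult_ac)
    then show ?thesis
      using L2_norm_nonneg[of "s A"] C(1) ell2_norm_nonneg[of "?r A"]
      by (cases "L2_norm (s A) = 0") auto
  qed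
  obtain F K where F: "\<And>k. finite (F k)" "F 0 = {}" "\<And>k::nat. F k \<subseteq> F (Suc k)" "0 \<le> K"
      "\<And>k. infsum ?q (- F k) \<le> K * (1/8) ^ k"
    using ell2_tail_exhaustion[OF c] by blast
  \<comment> \<open>The increments telescope to the partial sums over \<open>F n\<close>, because \<open>F 0\<close> is empty.\<close>
  define v where "v k = s (F (Suc k) - F k)" for k
  have partial: "(\<Sum>k<n. v k x) = s (F n) x" for n x
  proof (induction n)
    case (Suc n)
    have "s (F (Suc n)) x = s (F n) x + v n x"
      unfolding s_def v_def using F by (subst sum.subset_diff[of "F n"]) auto
    then show ?case using Suc by simp
  qed (simp add: s_def F)
  have v_norm: "(L2_norm (v k))\<^sup>2 \<le> C\<^sup>2 * K * (1/8) ^ k" for k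
  proof -
    have "(L2_norm (v k))\<^sup>2 \<le> (C * ell2_norm (?r (F (Suc k) - F k)))\<^sup>2"
      unfolding v_def by (intro power_mono norm_s L2_norm_nonneg) (simp add: F)
    also have "\<dots> = C\<^sup>2 * infsum ?q (F (Suc k) - F k)"
      by (simp only: power_mult_distrib ell2_restrict(2)[OF c])
    also have "\<dots> \<le> C\<^sup>2 * infsum ?q (- F k)"
      using c summable_on_subset_banach[of ?q UNIV "- F k"]
      by (intro mult_left_mono infsum_mono2) (auto simp: F ell2_def)
    also have "\<dots> \<le> C\<^sup>2 * (K * (1/8) ^ k)"
      by (intro mult_left_mono F) auto
    finally show ?thesis by (simp add: mult_ac)
  qed
  have "summable (\<lambda>k. 2 ^ k * (L2_norm (v k))\<^sup>2)"
  proof (rule summable_comparison_test')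
    show "summable (\<lambda>k. C\<^sup>2 * K * (1/4) ^ k)"
      by (intro summable_mult summable_geometric) auto
    fix k :: nat
    have "2 ^ k * (L2_norm (v k))\<^sup>2 \<le> 2 ^ k * (C\<^sup>2 * K * (1/8) ^ k)"
      by (intro mult_left_mono v_norm) auto
    also have "\<dots> = C\<^sup>2 * K * (2 * (1/8)) ^ k"
      by (simp only: power_mult_distrib mult_ac)
    finally show "norm (2 ^ k * (L2_norm (v k))\<^sup>2) \<le> C\<^sup>2 * K * (1/4) ^ k"
      by simp
  qed
  moreover have "v k \<in> L2" for k
    unfolding v_def by (rule sL2) (simp add: F)
  ultimately obtain u where u: "u \<in> L2" "(\<lambda>n. L2_norm (\<lambda>x. u x - s (F n) x)) \<longlonglongrightarrow> 0"
    using L2_series_converges[of v] unfolding partial by metis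
  show ?thesis
  proof (rule that[OF u(1)])
    fix h assume h: "h \<in> L2"
    have "(\<lambda>n. L2_inner h u - L2_inner h (s (F n))) \<longlonglongrightarrow> 0"
    proof (rule Lim_null_comparison)
      show "\<forall>\<^sub>F n in sequentially. cmod (L2_inner h u - L2_inner h (s (F n)))
          \<le> L2_norm h * L2_norm (\<lambda>x. u x - s (F n) x)"
        using h u(1) sL2 F(1)
        by (intro always_eventually allI, subst L2_inner_diff_right[symmetric])
           (auto intro!: L2_Cauchy_Schwarz L2_diff)
      show "(\<lambda>n. L2_norm h * L2_norm (\<lambda>x. u x - s (F n) x)) \<longlonglongrightarrow> 0"
        using tendsto_mult_right_zero[OF u(2)] .
    qed
    moreover have "(\<lambda>n. ell2_inner (?T h) c - L2_inner h (s (F n))) \<longlonglongrightarrow> 0"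
    proof (rule Lim_null_comparison)
      have "cmod (ell2_inner (?T h) c - L2_inner h (s (F n))) \<le> ell2_norm (?T h) * sqrt (K * (1/8) ^ n)" for n
      proof -
        have sm: "(\<lambda>i. ?T h i * cnj (?r A i)) summable_on UNIV" for A
          using ell2_mult_abs_summable[OF C(2)[OF h] ell2_restrict(1)[OF c]]
          by (rule abs_summable_summable)
        have "ell2_inner (?T h) c = (\<Sum>\<^sub>\<infinity>i. ?T h i * cnj (?r (F n) i) + ?T h i * cnj (?r (- F n) i))"
          unfolding ell2_inner_def by (rule infsum_cong) auto
        also have "\<dots> = ell2_inner (?T h) (?r (F n)) + ell2_inner (?T h) (?r (- F n))"
          unfolding ell2_inner_def by (rule infsum_add[OF sm sm])
        finally have "cmod (ell2_inner (?T h) c - L2_inner h (s (F n))) = cmod (ell2_inner (?T h) (?r (- F n)))"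
          using inner_s[OF F(1) h] by simp
        also have "\<dots> \<le> ell2_norm (?T h) * ell2_norm (?r (- F n))"
          by (intro ell2_Cauchy_Schwarz C h ell2_restrict c)
        also have "\<dots> \<le> ell2_norm (?T h) * sqrt (K * (1/8) ^ n)"
          using ell2_restrict(2)[OF c, of "- F n"] F(5)[of n]
          by (intro mult_left_mono ell2_norm_nonneg real_le_rsqrt) simp
        finally show ?thesis .
      qed
      then show "\<forall>\<^sub>F n in sequentially. cmod (ell2_inner (?T h) c - L2_inner h (s (F n)))
          \<le> ell2_norm (?T h) * sqrt (K * (1/8) ^ n)"
        by (intro always_eventually allI)
      have "(\<lambda>n. ell2_norm (?T h) * sqrt (K * (1/8) ^ n)) \<longlonglongrightarrow> ell2_norm (?T h) * sqrt (K * 0)"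
        by (intro tendsto_intros LIMSEQ_power_zero) auto
      then show "(\<lambda>n. ell2_norm (?T h) * sqrt (K * (1/8) ^ n)) \<longlonglongrightarrow> 0" by simp
    qed
    ultimately have "(\<lambda>n. (L2_inner h u - L2_inner h (s (F n))) - (ell2_inner (?T h) c - L2_inner h (s (F n)))) \<longlonglongrightarrow> 0 - 0"
      by (rule tendsto_diff)
    then show "L2_inner h u = ell2_inner (?T h) c"
      by (simp add: LIMSEQ_const_iff)
  qed
qed

section \<open>Characters and uniqueness of Fourier coefficients\<close>

definition character :: "real \<Rightarrow> real \<Rightarrow> complex" where
  "character \<omega> x = exp (2 * of_real pi * \<i> * of_real \<omega> * of_real x)"

lemma character_eq_cis: "character \<omega> x = cis (2 * pi * \<omega> * x)"
  by (simp add: character_def cis_conv_exp mult_ac)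

lemma norm_character [simp]: "cmod (character \<omega> x) = 1"
  by (simp add: character_eq_cis)

lemma character_zero [simp]: "character 0 x = 1"
  by (simp add: character_def)

lemma character_mult: "character \<omega> x * character \<omega>' x = character (\<omega> + \<omega>') x"
  by (simp add: character_eq_cis cis_mult algebra_simps)

lemma cnj_character: "cnj (character \<omega> x) = character (- \<omega>) x"
  by (simp add: character_eq_cis cis_cnj)

lemma character_add_integer:
  assumes "\<omega> * y \<in> \<int>"
  shows "character \<omega> (x + y) = character \<omega> x"
proof -
  obtain k :: int where k: "\<omega> * y = of_int k" using assms by (auto elim: Ints_cases)
  have "character \<omega> (x + y) = cis (2 * pi * \<omega> * x) * cis (2 * pi * (\<omega> * y))"
    by (simp add: character_eq_cis cis_mult algebra_simps)
  also have "cis (2 * pi * (\<omega> * y)) = 1"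
    unfolding k by (rule cis_multiple_2pi) simp
  finally show ?thesis by (simp add: character_eq_cis)
qed

lemma continuous_on_character: "continuous_on A (character \<omega>)"
  unfolding character_def[abs_def] by (intro continuous_intros)

lemma character_borel_measurable [measurable]: "character \<omega> \<in> borel_measurable borel"
  by (intro borel_measurable_continuous_onI continuous_on_character)

lemma integrable_bounded_mult:
  fixes F w :: "real \<Rightarrow> complex"
  assumes F: "integrable lborel F" and w: "w \<in> borel_measurable lborel" and M: "\<And>x. cmod (w x) \<le> M"
  shows "integrable lborel (\<lambda>x. F x * w x)"
proof (rule Bochner_Integration.integrable_bound)
  show "integrable lborel (\<lambda>x. M * cmod (F x))" using F by simp
  show "(\<lambda>x. F x * w x) \<in> borel_measurable lborel"
    using F[THEN borel_measurable_integrable] w by measurable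
  have "cmod (F x * w x) \<le> norm (M * cmod (F x))" for x
  proof -
    have "cmod (F x) * cmod (w x) \<le> cmod (F x) * M" by (intro mult_left_mono M) auto
    also have "\<dots> \<le> norm (M * cmod (F x))" by (simp add: mult.commute)
    finally show ?thesis by (simp add: norm_mult)
  qed
  then show "AE x in lborel. cmod (F x * w x) \<le> norm (M * cmod (F x))" by simp
qed

lemma integrable_mult_character:
  "integrable lborel F \<Longrightarrow> integrable lborel (\<lambda>x. F x * character \<omega> x)"
  by (rule integrable_bounded_mult[where M = 1]) auto

text \<open>
  The functions \<open>\<phi>\<close> for which multiplication by \<open>\<phi> \<circ> character (1 / L)\<close> preserves the vanishing of all
  Fourier coefficients form an algebra. It contains the linear functions, because on the unit
  circle these are combinations of the characters of frequency \<open>1\<close> and \<open>- 1\<close>, which only shift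
  the index. Quantifying over \<open>G\<close> is what makes products work in the induction.
\<close>

lemma polynomial_multiple_Fourier_zero:
  assumes "real_polynomial_function \<phi>"
  shows "\<lbrakk>integrable lborel G; \<And>m::int. (LINT x|lborel. G x * character (of_int m / L) x) = 0\<rbrakk> \<Longrightarrow>
    integrable lborel (\<lambda>x. G x * of_real (\<phi> (character (1 / L) x))) \<and>
    (\<forall>m::int. (LINT x|lborel. G x * of_real (\<phi> (character (1 / L) x)) * character (of_int m / L) x) = 0)"
  using assms
proof (induction \<phi> arbitrary: G rule: real_polynomial_function.induct)
  case (linear \<phi>)
  \<comment> \<open>The coefficients of the real linear \<open>\<phi>\<close> with respect to \<open>z\<close> and \<open>cnj z\<close>.\<close>
  define a b where "a = (of_real (\<phi> 1) - \<i> * of_real (\<phi> \<i>)) / 2"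
    and "b = (of_real (\<phi> 1) + \<i> * of_real (\<phi> \<i>)) / 2"
  have \<phi>: "complex_of_real (\<phi> z) = a * z + b * cnj z" for z
  proof -
    have lin: "linear \<phi>" using linear.hyps by (rule bounded_linear.linear)
    have "\<phi> z = \<phi> (Re z *\<^sub>R 1 + Im z *\<^sub>R \<i>)"
      by (rule arg_cong[of _ _ \<phi>]) (simp add: complex_eq_iff)
    then have "\<phi> z = Re z * \<phi> 1 + Im z * \<phi> \<i>"
      unfolding linear_add[OF lin] linear_scale[OF lin] by simp
    then show ?thesis by (simp add: a_def b_def complex_eq_iff field_simps)
  qed
  have ch: "G x * of_real (\<phi> (character (1 / L) x)) * character (of_int m / L) x =
      a * (G x * character (of_int (m + 1) / L) x) + b * (G x * character (of_int (m - 1) / L) x)" for x m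
  proof -
    have "character (1 / L) x * character (of_int m / L) x = character (of_int (m + 1) / L) x"
      "cnj (character (1 / L) x) * character (of_int m / L) x = character (of_int (m - 1) / L) x"
      by (simp_all add: cnj_character character_mult add_divide_distrib diff_divide_distrib add.commute)
    then show ?thesis unfolding \<phi> by (simp add: ring_distribs mult.assoc mult.left_commute)
  qed
  have ch0: "G x * of_real (\<phi> (character (1 / L) x)) =
      a * (G x * character (of_int 1 / L) x) + b * (G x * character (of_int (-1) / L) x)" for x
    using ch[of x 0] by simp
  have int: "integrable lborel (\<lambda>x. G x * character (of_int k / L) x)" for k
    by (rule integrable_mult_character) fact
  show ?case
  proof (intro conjI allI)
    show "integrable lborel (\<lambda>x. G x * of_real (\<phi> (character (1 / L) x)))"
      unfolding ch0 by (intro Bochner_Integration.integrable_add integrable_mult_right int)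
    show "(LINT x|lborel. G x * of_real (\<phi> (character (1 / L) x)) * character (of_int m / L) x) = 0" for m
      unfolding ch
      by (subst Bochner_Integration.integral_add)
        (auto simp only: integral_mult_right_zero linear.prems(2) mult_zero_right add_0_left
          intro!: integrable_mult_right int)
  qed
next
  case (const c)
  have "G x * of_real c * character (of_int m / L) x = of_real c * (G x * character (of_int m / L) x)" for x m
    by simp
  then show ?case
    using const by (simp only: integral_mult_right_zero mult_zero_right integrable_mult_left simp_thms)
next
  case (add f g)
  have int: "integrable lborel (\<lambda>x. G x * of_real (f (character (1 / L) x)))"
    "integrable lborel (\<lambda>x. G x * of_real (g (character (1 / L) x)))"
    using add by blast+
  then show ?case
    using add.IH[OF add.prems] int[THEN integrable_mult_character]
    by (simp add: ring_distribs)
next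
  case (mult f g)
  have 1: "integrable lborel (\<lambda>x. G x * of_real (f (character (1 / L) x)))"
    "\<And>m::int. (LINT x|lborel. G x * of_real (f (character (1 / L) x)) * character (of_int m / L) x) = 0"
    using mult.IH(1)[OF mult.prems] by blast+
  show ?case
    using mult.IH(2)[OF 1] by (simp add: mult.assoc)
qed

lemma continuous_multiple_integral_zero:
  fixes \<psi> :: "complex \<Rightarrow> real"
  assumes G: "integrable lborel G" "\<And>m::int. (LINT x|lborel. G x * character (of_int m / L) x) = 0"
    and \<psi>: "continuous_on UNIV \<psi>"
  shows "(LINT x|lborel. G x * of_real (\<psi> (character (1 / L) x))) = 0"
proof -
  let ?I = "\<lambda>\<psi>. LINT x|lborel. G x * of_real (\<psi> (character (1 / L) x))"
  define N where "N = (LINT x|lborel. cmod (G x))"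
  have N0: "0 \<le> N" by (simp add: N_def)
  have [measurable]: "\<psi> \<in> borel_measurable borel"
    by (intro borel_measurable_continuous_onI \<psi>)
  have bound: "cmod (?I \<psi>) \<le> \<epsilon> * N" if \<epsilon>: "0 < \<epsilon>" for \<epsilon>
  proof -
    obtain p where p: "real_polynomial_function p" "\<And>z. z \<in> sphere 0 1 \<Longrightarrow> \<bar>\<psi> z - p z\<bar> < \<epsilon>"
      using Stone_Weierstrass_real_polynomial_function[OF compact_sphere continuous_on_subset[OF \<psi>] \<epsilon>]
      by (metis subset_UNIV)
    have p_int: "integrable lborel (\<lambda>x. G x * of_real (p (character (1 / L) x)))" and p_zero: "?I p = 0"
      using polynomial_multiple_Fourier_zero[OF p(1) G] by (auto dest: spec[of _ 0])
    let ?D = "\<lambda>x. G x * of_real (\<psi> (character (1 / L) x) - p (character (1 / L) x))"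
    have small: "cmod (?D x) \<le> \<epsilon> * cmod (G x)" for x
    proof -
      have "cmod (?D x) = cmod (G x) * \<bar>\<psi> (character (1 / L) x) - p (character (1 / L) x)\<bar>"
        by (simp only: norm_mult norm_of_real)
      also have "\<dots> \<le> cmod (G x) * \<epsilon>"
        using p(2)[of "character (1 / L) x"] by (intro mult_left_mono) auto
      finally show ?thesis by (simp add: mult.commute)
    qed
    have meas: "?D \<in> borel_measurable lborel"
    proof -
      have "p \<in> borel_measurable borel"
        using p(1) by (intro borel_measurable_continuous_onI continuous_on_polymonial_function)
          (simp add: real_polynomial_function_eq)
      then show ?thesis using G(1)[THEN borel_measurable_integrable] by measurable
    qed
    have D_int: "integrable lborel ?D"
    proof (rule Bochner_Integration.integrable_bound)
      show "integrable lborel (\<lambda>x. \<epsilon> * cmod (G x))" using G(1) by simp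
      show "AE x in lborel. cmod (?D x) \<le> norm (\<epsilon> * cmod (G x))"
        using order_trans[OF small abs_ge_self] by (intro AE_I2) (simp only: real_norm_def)
    qed (rule meas)
    have "?I \<psi> = (LINT x|lborel. ?D x + G x * of_real (p (character (1 / L) x)))"
      by (simp add: algebra_simps)
    also have "\<dots> = (LINT x|lborel. ?D x)"
      using D_int p_int p_zero by (subst Bochner_Integration.integral_add) auto
    also have "cmod \<dots> \<le> (LINT x|lborel. \<epsilon> * cmod (G x))"
      using G(1) small D_int by (intro order_trans[OF integral_norm_bound] integral_mono) auto
    finally show ?thesis by (simp add: N_def)
  qed
  have "cmod (?I \<psi>) \<le> 0"
  proof (rule field_le_epsilon)
    fix \<epsilon> :: real assume \<epsilon>: "0 < \<epsilon>"
    have "cmod (?I \<psi>) \<le> \<epsilon> / (N + 1) * N" using bound[of "\<epsilon> / (N + 1)"] \<epsilon> N0 by simp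
    also have "\<dots> \<le> \<epsilon>" using \<epsilon> N0 by (simp add: field_simps)
    finally show "cmod (?I \<psi>) \<le> 0 + \<epsilon>" by simp
  qed
  then show ?thesis by simp
qed

text \<open>
  The indicator of a closed set is the bounded pointwise limit of the continuous functions
  \<open>max 0 (1 - n infdist z K)\<close>.
\<close>

lemma closed_indicator_integral_zero:
  fixes K :: "complex set"
  assumes G: "integrable lborel G" "\<And>m::int. (LINT x|lborel. G x * character (of_int m / L) x) = 0"
    and K: "closed K" "K \<noteq> {}"
  shows "(LINT x|lborel. G x * of_real (indicator K (character (1 / L) x))) = 0"
proof -
  define \<psi> :: "nat \<Rightarrow> complex \<Rightarrow> real" where "\<psi> n z = max 0 (1 - real n * infdist z K)" for n z
  have cont: "continuous_on UNIV (\<psi> n)" for n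
    unfolding \<psi>_def[abs_def] by (intro continuous_intros)
  have [measurable]: "\<psi> n \<in> borel_measurable borel" for n
    by (intro borel_measurable_continuous_onI cont)
  have [measurable]: "G \<in> borel_measurable lborel" "K \<in> sets borel"
    using G(1) K by auto
  have lim: "(\<lambda>n. \<psi> n z) \<longlonglongrightarrow> indicator K z" for z
  proof (cases "z \<in> K")
    case True
    then show ?thesis by (simp add: \<psi>_def)
  next
    case False
    then have d: "0 < infdist z K"
      using K infdist_pos_not_in_closed by blast
    obtain N where N: "1 < real N * infdist z K"
      using reals_Archimedean3[OF d] by blast
    have "\<psi> n z = 0" if "N \<le> n" for n
    proof -
      have "real N * infdist z K \<le> real n * infdist z K"
        using that d by (intro mult_right_mono) auto
      then show ?thesis using N by (simp add: \<psi>_def)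
    qed
    then have "\<forall>\<^sub>F n in sequentially. \<psi> n z = 0"
      by (auto simp: eventually_sequentially)
    then show ?thesis using False by (simp add: tendsto_eventually)
  qed
  have bnd: "\<bar>\<psi> n z\<bar> \<le> 1" for n z
    by (auto simp: \<psi>_def infdist_nonneg)
  have "(\<lambda>n. LINT x|lborel. G x * of_real (\<psi> n (character (1 / L) x)))
      \<longlonglongrightarrow> (LINT x|lborel. G x * of_real (indicator K (character (1 / L) x)))"
  proof (rule integral_dominated_convergence)
    show "integrable lborel (\<lambda>x. cmod (G x))" using G by simp
    show "AE x in lborel. (\<lambda>n. G x * of_real (\<psi> n (character (1 / L) x)))
        \<longlonglongrightarrow> G x * of_real (indicator K (character (1 / L) x))"
      by (intro AE_I2 tendsto_intros lim)
    show "AE x in lborel. cmod (G x * of_real (\<psi> n (character (1 / L) x))) \<le> cmod (G x)" for n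
      using bnd by (intro AE_I2) (simp add: norm_mult mult_left_le)
  qed measurable
  then show ?thesis
    by (simp add: continuous_multiple_integral_zero[OF G cont] LIMSEQ_const_iff)
qed

lemma character_inj:
  assumes L: "0 < L" and x: "x \<in> {s..<s + L}" "y \<in> {s..<s + L}"
    and eq: "character (1 / L) x = character (1 / L) y"
  shows "x = y"
proof -
  obtain n :: int where n: "2 * of_real pi * \<i> * of_real (1 / L) * of_real x
      = 2 * of_real pi * \<i> * of_real (1 / L) * of_real y + of_real (of_int (2 * n) * pi) * \<i>"
    using eq unfolding character_def exp_eq by blast
  have "2 * pi * (1 / L) * x = 2 * pi * (1 / L) * y + 2 * of_int n * pi"
    using arg_cong[OF n, of Im] by simp
  then have "2 * pi * (x - y) = 2 * pi * (of_int n * L)"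
    using L by (simp add: field_simps)
  then have d: "x - y = of_int n * L" by simp
  have "\<bar>x - y\<bar> < L" using x by auto
  then have "\<bar>of_int n :: real\<bar> < 1" using d L by (simp add: abs_mult)
  then have "n = 0" by linarith
  then show ?thesis using d by simp
qed

text \<open>
  A subinterval \<open>{c..d}\<close> of the period is the preimage of a closed set under the injective
  parametrisation of the circle, so \<open>F\<close> integrates to zero over every such interval. By Lebesgue's
  differentiation theorem, \<open>F\<close> is almost everywhere the limit of its averages over shrinking
  intervals, all of which vanish. Half-open cells match the right-sided intervals
  \<open>{x..x + h}\<close>: for \<open>x\<close> in the cell they stay inside for small \<open>h\<close>.
\<close>

lemma Fourier_coefficients_zero_imp_AE_zero:
  assumes L: "0 < L" and F: "integrable lborel F" and supp: "\<And>x. x \<notin> {s..<s + L} \<Longrightarrow> F x = 0"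
    and zero: "\<And>m::int. (LINT x|lborel. F x * character (of_int m / L) x) = 0"
  shows "AE x in lborel. F x = 0"
proof -
  have int_zero: "integral {c..d} F = 0" if cd: "s \<le> c" "c \<le> d" "d < s + L" for c d
  proof -
    let ?K = "character (1 / L) ` {c..d}"
    have K: "closed ?K" "?K \<noteq> {}"
      using cd by (auto intro!: compact_imp_closed compact_continuous_image continuous_on_character)
    have "F x * of_real (indicator ?K (character (1 / L) x)) = indicat_real {c..d} x *\<^sub>R F x" for x
    proof (cases "x \<in> {s..<s + L}")
      case True
      have "character (1 / L) x \<in> ?K \<longleftrightarrow> x \<in> {c..d}"
      proof
        assume "character (1 / L) x \<in> ?K"
        then obtain y where y: "y \<in> {c..d}" "character (1 / L) x = character (1 / L) y" by blast
        then have "x = y" using cd by (intro character_inj[OF L True]) auto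
        then show "x \<in> {c..d}" using y by simp
      qed simp
      then show ?thesis by (simp add: indicator_def)
    qed (simp add: supp)
    then have "(LINT x:{c..d}|lborel. F x) = 0"
      using closed_indicator_integral_zero[OF F zero K] by (simp add: set_lebesgue_integral_def)
    moreover have "set_integrable lborel {c..d} F"
      unfolding set_integrable_def using F by (intro integrable_mult_indicator) auto
    ultimately show ?thesis using set_borel_integral_eq_integral(2) by metis
  qed
  have "F integrable_on cbox a b" for a b
    using integrable_on_lborel[OF F] by (rule integrable_on_subcbox) auto
  then obtain N where N: "negligible N"
    "\<And>x e. \<lbrakk>x \<notin> N; 0 < e\<rbrakk> \<Longrightarrow> \<exists>d>0. \<forall>h. 0 < h \<and> h < d \<longrightarrow>
        norm (integral (cbox x (x + h *\<^sub>R One)) F /\<^sub>R h ^ DIM(real) - F x) < e"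
    using integrable_ccontinuous_explicit[of F] by blast
  have "F x = 0" if "x \<notin> N" for x
  proof (cases "x \<in> {s..<s + L}")
    case True
    have "cmod (F x) \<le> 0 + e" if e: "0 < e" for e
    proof -
      obtain d where d: "0 < d" "\<And>h. 0 < h \<and> h < d \<Longrightarrow>
          norm (integral (cbox x (x + h *\<^sub>R One)) F /\<^sub>R h ^ DIM(real) - F x) < e"
        using N(2)[OF \<open>x \<notin> N\<close> e] by blast
      define h where "h = min d (s + L - x) / 2"
      have h: "0 < h" "h < d" "x + h < s + L"
        using d(1) True by (auto simp: h_def min_def field_simps)
      have "integral {x..x + h} F = 0" using h True by (intro int_zero) auto
      then show ?thesis using d(2)[of h] h by simp
    qed
    then have "cmod (F x) \<le> 0" by (rule field_le_epsilon)
    then show ?thesis by simp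
  qed (simp add: supp)
  then have "AE x in lebesgue. F x = 0"
    using N(1) by (intro AE_I'[of N]) (auto simp: negligible_iff_null_sets)
  then show ?thesis by (simp add: AE_completion_iff)
qed

lemma character_integral:
  assumes L: "0 < L"
  shows "(LINT x|lborel. indicator {s..<s + L} x * character (of_int m / L) x) = of_real L * of_bool (m = (0::int))"
proof -
  let ?w = "of_int m / L"
  have ae: "(LINT x|lborel. indicator {s..<s + L} x * character ?w x)
      = (LINT x|lborel. indicat_real {s..s + L} x *\<^sub>R character ?w x)"
  proof (rule integral_cong_AE)
    show "AE x in lborel. indicator {s..<s + L} x * character ?w x = indicat_real {s..s + L} x *\<^sub>R character ?w x"
      using AE_lborel_singleton[of "s + L"] by eventually_elim (auto simp: indicator_def)
  qed measurable
  show ?thesis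
  proof (cases "m = 0")
    case True
    then show ?thesis unfolding ae using L by (simp add: scaleR_conv_of_real)
  next
    case False
    define k where "k = 2 * of_real pi * \<i> * complex_of_real ?w"
    have k: "k \<noteq> 0" using False L by (simp add: k_def)
    have "(LINT x|lborel. indicat_real {s..s + L} x *\<^sub>R character ?w x) 
        = character ?w (s + L) / k - character ?w s / k"
    proof (rule integral_FTC_Icc)
      show "((\<lambda>x. character ?w x / k) has_vector_derivative character ?w x) (at x within {s..s + L})" for x
      proof -
        have "((\<lambda>z. exp (k * z) / k) has_field_derivative exp (k * of_real x)) (at (of_real x))"
          using k by (auto intro!: derivative_eq_intros)
        then have "((\<lambda>x. exp (k * of_real x) / k) has_vector_derivative exp (k * of_real x)) (at x)"
          by (rule has_vector_derivative_real_field)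
        then show ?thesis
          by (simp add: character_def k_def has_vector_derivative_at_within)
      qed
    qed (use L in \<open>auto intro: continuous_on_character\<close>)
    also have "character ?w (s + L) = character ?w s"
      using L by (intro character_add_integer) auto
    finally show ?thesis using False by (simp add: ae)
  qed
qed

section \<open>Parseval's identity on an interval\<close>

text \<open>
  The characters of period \<open>L\<close> cut off to one period, which turns Fourier coefficients
  on \<open>[s, s + L)\<close> into inner products of \<open>L\<^sup>2\<close> of the line. They are orthogonal with squared norm \<open>L\<close>.
\<close>

definition windowed_character :: "real \<Rightarrow> real \<Rightarrow> int \<Rightarrow> real \<Rightarrow> complex" where
  "windowed_character s L m x = indicator {s..<s + L} x * character (of_int m / L) x"

lemma windowed_character_L2: "windowed_character s L m \<in> L2"
proof (rule L2_bounded_support[where M = 1])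
  show "windowed_character s L m \<in> borel_measurable lborel"
    unfolding windowed_character_def[abs_def] by measurable
qed (auto simp: windowed_character_def norm_mult indicator_def)

lemma windowed_character_orthogonal:
  assumes "0 < L"
  shows "L2_inner (windowed_character s L m) (windowed_character s L n) = of_real L * of_bool (m = n)"
proof -
  have "windowed_character s L m x * cnj (windowed_character s L n x)
      = indicator {s..<s + L} x * character (of_int (m - n) / L) x" for x
    by (auto simp: windowed_character_def indicator_def cnj_character character_mult diff_divide_distrib)
  then show ?thesis
    unfolding L2_inner_def using character_integral[OF assms, of s "m - n"] by simp
qed

text \<open>
  For a finite index set \<open>M\<close> let \<open>u\<close> be the partial sum with the coefficients of \<open>h\<close>, and \<open>S\<close> the sum of
  their squared moduli. Orthogonality gives \<open>\<langle>h, u\<rangle> = S\<close> and \<open>\<parallel>u\<parallel>\<^sup>2 = L S\<close>, so the Cauchy-Schwarz inequality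
  yields \<open>S\<^sup>2 \<le> L S \<parallel>h\<parallel>\<^sup>2\<close>.
\<close>

lemma Bessel_windowed_character:
  assumes L: "0 < L" and h: "h \<in> L2"
  shows "(\<lambda>m. L2_inner h (windowed_character s L m)) \<in> ell2"
    and "(ell2_norm (\<lambda>m. L2_inner h (windowed_character s L m)))\<^sup>2 \<le> L * (L2_norm h)\<^sup>2"
proof -
  let ?E = "windowed_character s L"
  let ?c = "\<lambda>m. L2_inner h (?E m)"
  have fin: "(\<Sum>m\<in>M. (cmod (?c m))\<^sup>2) \<le> L * (L2_norm h)\<^sup>2" if M: "finite M" for M
  proof -
    define u where "u x = (\<Sum>m\<in>M. ?c m * ?E m x)" for x
    define S where "S = (\<Sum>m\<in>M. (cmod (?c m))\<^sup>2)"
    have S0: "0 \<le> S" by (simp add: S_def sum_nonneg)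
    have u: "u \<in> L2"
      unfolding u_def[abs_def] by (intro L2_sum L2_scale windowed_character_L2 M)
    have inner_u: "L2_inner f u = (\<Sum>m\<in>M. cnj (?c m) * L2_inner f (?E m))" if "f \<in> L2" for f
      unfolding u_def[abs_def] using M that
      by (subst L2_inner_sum_right) (auto simp: L2_inner_scale_right intro: L2_scale windowed_character_L2)
    have hu: "L2_inner h u = of_real S"
      unfolding inner_u[OF h] S_def by (simp add: complex_norm_square mult.commute del: of_real_power)
    have Eu: "L2_inner u (?E m) = of_real L * ?c m" if "m \<in> M" for m
    proof -
      have "L2_inner (?E m) u = (\<Sum>n\<in>M. cnj (?c n) * (of_real L * of_bool (m = n)))"
        by (simp add: inner_u windowed_character_L2 windowed_character_orthogonal[OF L])
      also have "\<dots> = cnj (?c m) * of_real L"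
        using that M by (simp add: of_bool_def if_distrib sum.delta cong: if_cong)
      finally show ?thesis
        by (subst L2_inner_commute) (simp add: mult.commute)
    qed
    have "L2_inner u u = of_real (L * S)"
      unfolding inner_u[OF u] S_def
      by (simp add: Eu complex_norm_square mult_ac sum_distrib_left del: of_real_power)
    then have "(L2_norm u)\<^sup>2 = L * S"
      unfolding L2_inner_self of_real_eq_iff .
    moreover have "S \<le> L2_norm h * L2_norm u"
      using L2_Cauchy_Schwarz[OF h u] S0 by (simp add: hu)
    then have "S\<^sup>2 \<le> (L2_norm h * L2_norm u)\<^sup>2"
      using S0 by (intro power_mono)
    ultimately have "S * S \<le> L * (L2_norm h)\<^sup>2 * S"
      by (simp add: power2_eq_square power_mult_distrib mult_ac)
    then show ?thesis
      using S0 L by (cases "S = 0") (auto simp: S_def[symmetric])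
  qed
  have sm: "(\<lambda>m. (cmod (?c m))\<^sup>2) summable_on UNIV"
  proof (rule nonneg_bdd_above_summable_on)
    show "bdd_above (sum (\<lambda>m. (cmod (?c m))\<^sup>2) ` {F. F \<subseteq> UNIV \<and> finite F})"
      using fin by (intro bdd_aboveI[of _ "L * (L2_norm h)\<^sup>2"]) auto
  qed simp
  then show "?c \<in> ell2" by (simp add: ell2_def)
  show "(ell2_norm ?c)\<^sup>2 \<le> L * (L2_norm h)\<^sup>2"
    unfolding ell2_norm_squared by (rule infsum_le_finite_sums[OF sm fin])
qed

text \<open>
  Bessel's inequality makes the coefficient map bounded, so the Fourier series of \<open>B\<close> can be synthesised
  to a function \<open>u\<close>. It has the same coefficients as \<open>L B\<close>, hence coincides with \<open>L B\<close> on the period by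
  uniqueness. Pairing with \<open>A\<close> gives the identity; only the part of \<open>A\<close> on the period
  enters either side.
\<close>

lemma Parseval_windowed_character:
  assumes L: "0 < L" and A: "A \<in> L2" and B: "B \<in> L2"
    and supp: "\<And>x. x \<notin> {s..<s + L} \<Longrightarrow> B x = 0"
  shows "ell2_inner (\<lambda>m. L2_inner A (windowed_character s L m)) (\<lambda>m. L2_inner B (windowed_character s L m))
    = of_real L * L2_inner A B"
proof -
  let ?E = "windowed_character s L"
  let ?T = "\<lambda>h m. L2_inner h (?E m)"
  have "bounded_L2_ell2 ?T"
    unfolding bounded_L2_ell2_def
  proof (intro exI ballI conjI)
    fix h assume h: "h \<in> L2"
    show "?T h \<in> ell2" by (rule Bessel_windowed_character[OF L h])
    show "ell2_norm (?T h) \<le> sqrt L * L2_norm h"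
      using Bessel_windowed_character(2)[OF L h, of s] L L2_norm_nonneg[of h]
      by (intro power2_le_imp_le[of "ell2_norm _"]) (auto simp: power_mult_distrib)
  qed
  then obtain u where u: "u \<in> L2" "\<And>h. h \<in> L2 \<Longrightarrow> L2_inner h u = ell2_inner (?T h) (?T B)"
    using synthesis_exists[of ?E, OF windowed_character_L2 _ Bessel_windowed_character(1)[OF L B]] by blast
  define w where "w x = u x - of_real L * B x" for x
  have w: "w \<in> L2" unfolding w_def[abs_def] by (intro L2_diff L2_scale u B)
  have wE: "L2_inner w (?E m) = 0" for m
  proof -
    have "L2_inner (?E m) u = (\<Sum>\<^sub>\<infinity>n. of_real L * of_bool (m = n) * cnj (L2_inner B (?E n)))"
      by (simp add: u(2) windowed_character_L2 ell2_inner_def windowed_character_orthogonal[OF L])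
    also have "\<dots> = (\<Sum>\<^sub>\<infinity>n\<in>{m}. of_real L * of_bool (m = n) * cnj (L2_inner B (?E n)))"
      by (rule infsum_cong_neutral) auto
    also have "\<dots> = of_real L * L2_inner (?E m) B"
      by (simp add: L2_inner_commute[of "?E m" B])
    finally have "L2_inner (?E m) w = 0"
      unfolding w_def[abs_def]
      by (subst L2_inner_diff_right)
        (auto simp: windowed_character_L2 u B L2_scale L2_inner_scale_right)
    then show ?thesis by (subst L2_inner_commute) simp
  qed
  \<comment> \<open>The conjugate of \<open>?E 0\<close> is the indicator of the interval.\<close>
  have "AE x in lborel. w x * cnj (windowed_character s L 0 x) = 0"
  proof (rule Fourier_coefficients_zero_imp_AE_zero[OF L])
    show "integrable lborel (\<lambda>x. w x * cnj (?E 0 x))"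
      by (intro L2_mult_integrable w windowed_character_L2)
    show "w x * cnj (?E 0 x) = 0" if "x \<notin> {s..<s + L}" for x
      using that by (auto simp: windowed_character_def)
    show "(LINT x|lborel. w x * cnj (?E 0 x) * character (of_int m / L) x) = 0" for m
    proof -
      have "w x * cnj (?E 0 x) * character (of_int m / L) x = w x * cnj (?E (- m) x)" for x
        by (simp add: windowed_character_def cnj_character indicator_def)
      then show ?thesis using wE[of "- m"] unfolding L2_inner_def by presburger
    qed
  qed
  then have AE: "AE x in lborel. x \<in> {s..<s + L} \<longrightarrow> u x = of_real L * B x"
    by eventually_elim (auto simp: w_def windowed_character_def)
  define A' where "A' x = indicator {s..<s + L} x * A x" for x
  have A': "A' \<in> L2"
    unfolding A'_def[abs_def] by (rule L2_mult_bounded[OF A, where M = 1]) (auto simp: indicator_def)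
  have "?T A = ?T A'"
    unfolding L2_inner_def windowed_character_def A'_def
    by (intro ext Bochner_Integration.integral_cong) (auto simp: indicator_def)
  then have "ell2_inner (?T A) (?T B) = L2_inner A' u"
    using u(2)[OF A'] by simp
  also have "\<dots> = (LINT x|lborel. of_real L * (A x * cnj (B x)))"
    unfolding L2_inner_def
  proof (rule integral_cong_AE)
    have [measurable]: "A \<in> borel_measurable lborel" "B \<in> borel_measurable lborel" "u \<in> borel_measurable lborel"
        "A' \<in> borel_measurable lborel"
      using A B u A' by (auto dest: L2_measurable)
    show "(\<lambda>x. A' x * cnj (u x)) \<in> borel_measurable lborel"
      "(\<lambda>x. of_real L * (A x * cnj (B x))) \<in> borel_measurable lborel"
      by measurable
    show "AE x in lborel. A' x * cnj (u x) = of_real L * (A x * cnj (B x))"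
      using AE by eventually_elim (auto simp: A'_def indicator_def supp)
  qed
  finally show ?thesis by (simp add: L2_inner_def)
qed

section \<open>Periodisation of integrable functions\<close>

interpretation int_real: pair_sigma_finite "count_space (UNIV :: int set)" "lborel :: real measure"
  unfolding pair_sigma_finite_def
  by (intro conjI sigma_finite_measure_count_space lborel.sigma_finite_measure_axioms)

lemma measurable_int_real_pair:
  assumes "\<And>n. f n \<in> borel_measurable lborel"
  shows "(\<lambda>(n::int, x::real). f n x) \<in> borel_measurable (count_space UNIV \<Otimes>\<^sub>M lborel)"
  by (rule measurable_pair_measure_countable1) (use assms in auto)

lemma nn_integral_int_swap:
  fixes f :: "int \<Rightarrow> real \<Rightarrow> ennreal"
  assumes "\<And>n. f n \<in> borel_measurable lborel"
  shows "(\<integral>\<^sup>+n. \<integral>\<^sup>+x. f n x \<partial>lborel \<partial>count_space UNIV) = (\<integral>\<^sup>+x. \<integral>\<^sup>+n. f n x \<partial>count_space UNIV \<partial>lborel)"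
  using int_real.Fubini'[of f, OF measurable_int_real_pair[OF assms]] by simp

text \<open>
  Exchange of an absolutely convergent series with the integral, by Fubini's theorem for the
  counting measure on the integers.
\<close>

lemma integral_int_series:
  fixes F :: "int \<Rightarrow> real \<Rightarrow> complex"
  assumes meas: "\<And>n. F n \<in> borel_measurable lborel"
    and fin: "(\<integral>\<^sup>+n. \<integral>\<^sup>+x. cmod (F n x) \<partial>lborel \<partial>count_space UNIV) < \<infinity>"
  shows "integrable lborel (\<lambda>x. LINT n|count_space UNIV. F n x)"
    and "(\<Sum>\<^sub>\<infinity>n. LINT x|lborel. F n x) = (LINT x|lborel. LINT n|count_space UNIV. F n x)"
proof -
  have int: "integrable (count_space UNIV \<Otimes>\<^sub>M lborel) (case_prod F)"
  proof (rule integrableI_bounded)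
    show m: "case_prod F \<in> borel_measurable (count_space UNIV \<Otimes>\<^sub>M lborel)"
      by (rule measurable_int_real_pair) (rule meas)
    have "(\<integral>\<^sup>+p. cmod (case_prod F p) \<partial>(count_space UNIV \<Otimes>\<^sub>M lborel))
        = (\<integral>\<^sup>+n. \<integral>\<^sup>+x. cmod (F n x) \<partial>lborel \<partial>count_space UNIV)"
      using m by (subst lborel.nn_integral_fst[symmetric]) auto
    then show "(\<integral>\<^sup>+p. cmod (case_prod F p) \<partial>(count_space UNIV \<Otimes>\<^sub>M lborel)) < \<infinity>"
      using fin by simp
  qed
  show "integrable lborel (\<lambda>x. LINT n|count_space UNIV. F n x)"
    by (rule int_real.integrable_snd[OF int])
  have "integrable (count_space UNIV) (\<lambda>n. LINT x|lborel. F n x)"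
    using int_real.integrable_fst'[OF int] by simp
  then have "(\<Sum>\<^sub>\<infinity>n. LINT x|lborel. F n x) = (LINT n|count_space UNIV. LINT x|lborel. F n x)"
    using infsetsum_infsum[of "\<lambda>n. LINT x|lborel. F n x" UNIV]
    by (simp add: infsetsum_def Infinite_Set_Sum.abs_summable_on_def)
  also have "\<dots> = (LINT x|lborel. LINT n|count_space UNIV. F n x)"
    using int_real.Fubini_integral[OF int] by simp
  finally show "(\<Sum>\<^sub>\<infinity>n. LINT x|lborel. F n x) = (LINT x|lborel. LINT n|count_space UNIV. F n x)" .
qed

text \<open>
  The shifts of a half-open cell by multiples of its length tile the line.
\<close>

lemma unique_shift:
  assumes L: "0 < (L::real)"
  obtains k :: int where "\<And>n::int. x + L * of_int n \<in> {s..<s + L} \<longleftrightarrow> n = k"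
proof (rule that[of "- \<lfloor>(x - s) / L\<rfloor>"])
  fix n :: int
  have "x + L * of_int n \<in> {s..<s + L} \<longleftrightarrow> of_int (- n) \<le> (x - s) / L \<and> (x - s) / L < of_int (- n) + 1"
    using L by (auto simp: field_simps)
  also have "\<dots> \<longleftrightarrow> \<lfloor>(x - s) / L\<rfloor> = - n"
    by (simp only: floor_eq_iff)
  finally show "x + L * of_int n \<in> {s..<s + L} \<longleftrightarrow> n = - \<lfloor>(x - s) / L\<rfloor>" by auto
qed

lemma integral_count_space_single:
  fixes c :: complex
  shows "(LINT n|count_space UNIV. of_bool (n = k) * c) = c"
proof -
  have "(LINT n|count_space UNIV. of_bool (n = k) * c) = (LINT n|count_space UNIV. indicat_real {k} n *\<^sub>R c)"
    by (rule Bochner_Integration.integral_cong) (auto simp: indicator_def)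
  then show ?thesis by simp
qed

lemma nn_integral_count_space_single:
  fixes c :: ennreal
  shows "(\<integral>\<^sup>+n. of_bool (n = k) * c \<partial>count_space UNIV) = c"
proof -
  have "(\<integral>\<^sup>+n. of_bool (n = k) * c \<partial>count_space UNIV) = (\<integral>\<^sup>+n. c * indicator {k} n \<partial>count_space UNIV)"
    by (rule nn_integral_cong) (auto simp: indicator_def)
  then show ?thesis by (simp add: nn_integral_cmult_indicator)
qed

definition periodization :: "real \<Rightarrow> real \<Rightarrow> (real \<Rightarrow> complex) \<Rightarrow> real \<Rightarrow> complex" where
  "periodization s L G x = (LINT n|count_space UNIV. indicator {s..<s + L} x * G (x - L * of_int n))"

lemma periodization_support: "x \<notin> {s..<s + L} \<Longrightarrow> periodization s L G x = 0"
  by (simp add: periodization_def)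

lemma translates_on_cell_mass:
  fixes G :: "real \<Rightarrow> complex"
  assumes G [measurable]: "G \<in> borel_measurable lborel" and L: "0 < L"
  shows "(\<integral>\<^sup>+n. \<integral>\<^sup>+x. ennreal (indicator {s..<s + L} x * cmod (G (x - L * of_int n))) \<partial>lborel \<partial>count_space UNIV)
    = (\<integral>\<^sup>+x. cmod (G x) \<partial>lborel)"
proof -
  let ?S = "{s..<s + L}"
  have "(\<integral>\<^sup>+n. \<integral>\<^sup>+x. ennreal (indicator ?S x * cmod (G (x - L * of_int n))) \<partial>lborel \<partial>count_space UNIV)
    = (\<integral>\<^sup>+n. \<integral>\<^sup>+x. ennreal (indicator ?S (x + L * of_int n) * cmod (G x)) \<partial>lborel \<partial>count_space UNIV)"
  proof (rule nn_integral_cong)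
    fix n :: int
    show "(\<integral>\<^sup>+x. ennreal (indicator ?S x * cmod (G (x - L * of_int n))) \<partial>lborel)
        = (\<integral>\<^sup>+x. ennreal (indicator ?S (x + L * of_int n) * cmod (G x)) \<partial>lborel)"
      by (subst nn_integral_real_affine[where c = 1 and t = "L * of_int n"]) (auto simp: add.commute)
  qed
  also have "\<dots> = (\<integral>\<^sup>+x. \<integral>\<^sup>+n. ennreal (indicator ?S (x + L * of_int n) * cmod (G x)) \<partial>count_space UNIV \<partial>lborel)"
    by (rule nn_integral_int_swap) measurable
  also have "\<dots> = (\<integral>\<^sup>+x. cmod (G x) \<partial>lborel)"
  proof (rule nn_integral_cong)
    fix x
    obtain k :: int where k: "\<And>n::int. x + L * of_int n \<in> ?S \<longleftrightarrow> n = k"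
      using unique_shift[OF L] by blast
    have "ennreal (indicator ?S (x + L * of_int n) * cmod (G x)) = of_bool (n = k) * ennreal (cmod (G x))" for n
      using k[of n] by (auto simp: indicator_def)
    then show "(\<integral>\<^sup>+n. ennreal (indicator ?S (x + L * of_int n) * cmod (G x)) \<partial>count_space UNIV)
        = ennreal (cmod (G x))"
      by (simp only: nn_integral_count_space_single)
  qed
  finally show ?thesis .
qed

lemma weighted_translates_on_cell_mass_finite:
  fixes G w :: "real \<Rightarrow> complex"
  assumes G: "integrable lborel G" and L: "0 < L"
    and w [measurable]: "w \<in> borel_measurable lborel" and M: "\<And>x. cmod (w x) \<le> M"
  shows "(\<integral>\<^sup>+n. \<integral>\<^sup>+x. cmod (w x * (indicator {s..<s + L} x * G (x - L * of_int n))) \<partial>lborel \<partial>count_space UNIV) < \<infinity>"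
proof -
  have [measurable]: "G \<in> borel_measurable lborel" using G by simp
  let ?S = "{s..<s + L}"
  have M0: "0 \<le> M" using M[of 0] norm_ge_zero order_trans by blast
  have "(\<integral>\<^sup>+n. \<integral>\<^sup>+x. cmod (w x * (indicator ?S x * G (x - L * of_int n))) \<partial>lborel \<partial>count_space UNIV)
     \<le> (\<integral>\<^sup>+n. \<integral>\<^sup>+x. ennreal M * ennreal (indicator ?S x * cmod (G (x - L * of_int n))) \<partial>lborel \<partial>count_space UNIV)"
  proof (intro nn_integral_mono)
    fix n :: int and x
    have "cmod (w x * (indicator ?S x * G (x - L * of_int n))) \<le> M * (indicator ?S x * cmod (G (x - L * of_int n)))"
      unfolding norm_mult using M by (intro mult_mono M0) (auto simp: indicator_def)
    then show "ennreal (cmod (w x * (indicator ?S x * G (x - L * of_int n))))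
        \<le> ennreal M * ennreal (indicator ?S x * cmod (G (x - L * of_int n)))"
      by (metis ennreal_leI ennreal_mult' M0)
  qed
  also have "\<dots> = ennreal M * (\<integral>\<^sup>+x. cmod (G x) \<partial>lborel)"
    by (simp add: nn_integral_cmult translates_on_cell_mass[OF _ L])
  also have "\<dots> < \<infinity>"
    using G by (simp add: ennreal_mult_less_top integrable_iff_bounded)
  finally show ?thesis .
qed

lemma integrable_periodization:
  assumes "integrable lborel G" "0 < L"
  shows "integrable lborel (periodization s L G)"
proof -
  have [measurable]: "G \<in> borel_measurable lborel" using assms by simp
  show ?thesis
    using integral_int_series(1)[OF _ weighted_translates_on_cell_mass_finite[OF assms, of "\<lambda>_. 1" 1 s]]
    unfolding periodization_def[abs_def] by simp
qed

text \<open>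
  The weight \<open>w\<close> lives on one cell, so that the series of the translates of \<open>G\<close> enters only there, where
  its total mass is the \<open>L\<^sup>1\<close> norm of \<open>G\<close>.
\<close>

lemma periodization_series:
  fixes G w :: "real \<Rightarrow> complex"
  assumes G: "integrable lborel G" and L: "0 < L"
    and w [measurable]: "w \<in> borel_measurable lborel" and M: "\<And>x. cmod (w x) \<le> M"
    and supp: "\<And>x. x \<notin> {s..<s + L} \<Longrightarrow> w x = 0"
  shows "(\<Sum>\<^sub>\<infinity>n::int. LINT x|lborel. w x * G (x - L * of_int n)) = (LINT x|lborel. w x * periodization s L G x)"
proof -
  have [measurable]: "G \<in> borel_measurable lborel" using G by simp
  let ?S = "{s..<s + L}"
  have "w x * G (x - L * of_int n) = w x * (indicator ?S x * G (x - L * of_int n))" for x n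
    using supp[of x] by (cases "x \<in> ?S") auto
  then have "(\<Sum>\<^sub>\<infinity>n::int. LINT x|lborel. w x * G (x - L * of_int n))
      = (\<Sum>\<^sub>\<infinity>n::int. LINT x|lborel. w x * (indicator ?S x * G (x - L * of_int n)))"
    by (simp only:)
  also have "\<dots> = (LINT x|lborel. LINT n|count_space UNIV. w x * (indicator ?S x * G (x - L * of_int n)))"
    by (rule integral_int_series(2)[OF _ weighted_translates_on_cell_mass_finite[OF G L w M]]) measurable
  also have "\<dots> = (LINT x|lborel. w x * periodization s L G x)"
    unfolding periodization_def by (intro Bochner_Integration.integral_cong refl) (rule integral_mult_right_zero)
  finally show ?thesis .
qed

text \<open>
  Unfolding: periodicity of \<open>W\<close> turns the \<open>n\<close>-th integral over the cell into the integral of \<open>W G\<close> over the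
  cell shifted by \<open>- L n\<close>, and these shifted cells tile the line.
\<close>

lemma integral_periodic_unfold:
  fixes G W :: "real \<Rightarrow> complex"
  assumes G: "integrable lborel G" and L: "0 < L"
    and W [measurable]: "W \<in> borel_measurable lborel" and M: "\<And>x. cmod (W x) \<le> M"
    and per: "\<And>x (n::int). W (x + L * of_int n) = W x"
  shows "(\<Sum>\<^sub>\<infinity>n::int. LINT x|lborel. indicator {s..<s + L} x * W x * G (x - L * of_int n)) = (LINT x|lborel. W x * G x)"
proof -
  have [measurable]: "G \<in> borel_measurable lborel" using G by simp
  let ?S = "{s..<s + L}"
  have shift: "(LINT x|lborel. indicator ?S x * W x * G (x - L * of_int n))
      = (LINT x|lborel. indicator ?S (x + L * of_int n) * (W x * G x))" for n :: int
    using lborel_integral_real_affine[of 1 "\<lambda>x. indicator ?S x * W x * G (x - L * of_int n)" "L * of_int n"]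
    by (simp add: per add.commute mult.assoc)
  have "(\<integral>\<^sup>+n. \<integral>\<^sup>+x. cmod (indicator ?S (x + L * of_int n) * (W x * G x)) \<partial>lborel \<partial>count_space UNIV)
      = (\<integral>\<^sup>+n. \<integral>\<^sup>+x. cmod (W x * (indicator ?S x * G (x - L * of_int n))) \<partial>lborel \<partial>count_space UNIV)"
  proof (rule nn_integral_cong)
    fix n :: int
    show "(\<integral>\<^sup>+x. cmod (indicator ?S (x + L * of_int n) * (W x * G x)) \<partial>lborel)
        = (\<integral>\<^sup>+x. cmod (W x * (indicator ?S x * G (x - L * of_int n))) \<partial>lborel)"
      by (subst (2) nn_integral_real_affine[where c = 1 and t = "L * of_int n"])
        (auto simp: add.commute per mult.left_commute)
  qed
  then have "(\<integral>\<^sup>+n. \<integral>\<^sup>+x. cmod (indicator ?S (x + L * of_int n) * (W x * G x)) \<partial>lborel \<partial>count_space UNIV) < \<infinity>"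
    using weighted_translates_on_cell_mass_finite[OF G L W M, of s] by simp
  then have "(\<Sum>\<^sub>\<infinity>n::int. LINT x|lborel. indicator ?S (x + L * of_int n) * (W x * G x))
      = (LINT x|lborel. LINT n|count_space UNIV. indicator ?S (x + L * of_int n) * (W x * G x))"
    by (intro integral_int_series(2)) measurable
  also have "\<dots> = (LINT x|lborel. W x * G x)"
  proof (intro Bochner_Integration.integral_cong refl)
    fix x
    obtain k :: int where k: "\<And>n::int. x + L * of_int n \<in> ?S \<longleftrightarrow> n = k"
      using unique_shift[OF L] by blast
    have "indicator ?S (x + L * of_int n) * (W x * G x) = of_bool (n = k) * (W x * G x)" for n
      using k[of n] by (auto simp: indicator_def)
    then show "(LINT n|count_space UNIV. indicator ?S (x + L * of_int n) * (W x * G x)) = W x * G x"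
      by (simp only: integral_count_space_single)
  qed
  finally show ?thesis unfolding shift .
qed

section \<open>Weyl-Heisenberg coefficients of functions on cells\<close>

lemma WH_system_apply:
  "WH_system \<alpha> \<beta> f (m, n) x = character (\<alpha> * of_int m) x * f (x - \<beta> * of_int n)"
  by (simp add: WH_system_def modulation_def translation_def character_def)

lemma WH_system_L2:
  assumes "f \<in> L2"
  shows "WH_system \<alpha> \<beta> f p \<in> L2"
proof (cases p)
  case (Pair m n)
  have "(\<lambda>x. character (\<alpha> * of_int m) x * f (x - \<beta> * of_int n)) \<in> L2"
    by (rule L2_mult_bounded[OF L2_shift[OF assms], where M = 1]) auto
  moreover have "WH_system \<alpha> \<beta> f p = (\<lambda>x. character (\<alpha> * of_int m) x * f (x - \<beta> * of_int n))"
    by (intro ext) (simp only: Pair WH_system_apply)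
  ultimately show ?thesis by simp
qed

lemma coeff_map_synthesis:
  assumes "f \<in> L2" "bounded_L2_ell2 (coeff_map \<alpha> \<beta> f)" "c \<in> ell2"
  shows "\<exists>u. u \<in> L2 \<and> (\<forall>h\<in>L2. L2_inner h u = ell2_inner (coeff_map \<alpha> \<beta> f h) c)"
proof -
  have eq: "coeff_map \<alpha> \<beta> f = (\<lambda>h p. L2_inner h (WH_system \<alpha> \<beta> f p))"
    by (intro ext) (simp only: coeff_map_def)
  obtain u where "u \<in> L2"
    "\<And>h. h \<in> L2 \<Longrightarrow> L2_inner h u = ell2_inner (\<lambda>p. L2_inner h (WH_system \<alpha> \<beta> f p)) c"
    using synthesis_exists[of "WH_system \<alpha> \<beta> f", OF WH_system_L2[OF assms(1)] _ assms(3)] assms(2)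
    unfolding eq by blast
  then show ?thesis unfolding eq by blast
qed

text \<open>
  The choice made in the definition of the adjoint is harmless: a vector with the adjoint's defining property exists by
  synthesis and is determined almost everywhere by its inner products.
\<close>

lemma L2_adjoint_AE_eq_iff:
  assumes f: "f \<in> L2" and bdd: "bounded_L2_ell2 (coeff_map \<alpha> \<beta> f)" and c: "c \<in> ell2" and h: "h \<in> L2"
  shows "(AE x in lborel. L2_adjoint (coeff_map \<alpha> \<beta> f) c x = h x)
    \<longleftrightarrow> (\<forall>k\<in>L2. ell2_inner (coeff_map \<alpha> \<beta> f k) c = L2_inner k h)"
proof -
  let ?u = "L2_adjoint (coeff_map \<alpha> \<beta> f) c"
  have "?u \<in> L2 \<and> (\<forall>h\<in>L2. L2_inner h ?u = ell2_inner (coeff_map \<alpha> \<beta> f h) c)"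
    unfolding L2_adjoint_def by (rule someI_ex[OF coeff_map_synthesis[OF f bdd c]])
  then have u: "?u \<in> L2" "\<And>k. k \<in> L2 \<Longrightarrow> L2_inner k ?u = ell2_inner (coeff_map \<alpha> \<beta> f k) c"
    by blast+
  have "(AE x in lborel. ?u x = h x) \<longleftrightarrow> (\<forall>k\<in>L2. L2_inner k ?u = L2_inner k h)"
    by (rule L2_eq_AE_iff_inner[OF u(1) h])
  also have "\<dots> \<longleftrightarrow> (\<forall>k\<in>L2. ell2_inner (coeff_map \<alpha> \<beta> f k) c = L2_inner k h)"
    by (rule ball_cong[OF refl]) (simp only: u(2))
  finally show ?thesis .
qed

text \<open>
  For fixed \<open>n\<close> both coefficient families are Fourier coefficients on the
  interval \<open>[s, s + 1/\<alpha>)\<close>: those of \<open>A n\<close> for \<open>h\<close>, and, after the substitution of \<open>x - j/\<alpha>\<close> for \<open>x\<close>, those of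
  \<open>B n\<close> for the translate of \<open>\<kappa>\<close>. The substitution leaves the modulations alone because
  \<open>\<alpha> m \<cdot> j/\<alpha>\<close> is an integer. Parseval's identity then sums over \<open>m\<close>.
\<close>

lemma coeff_map_cell_pairing:
  assumes \<alpha>: "0 < \<alpha>" and g: "g \<in> L2" and \<gamma>: "\<gamma> \<in> L2"
    and bg: "bounded_L2_ell2 (coeff_map \<alpha> \<beta> g)" and b\<gamma>: "bounded_L2_ell2 (coeff_map \<alpha> \<beta> \<gamma>)"
    and h: "h \<in> borel_measurable lborel" "\<And>x. cmod (h x) \<le> H" "\<And>x. x \<notin> {s..<s + 1 / \<alpha>} \<Longrightarrow> h x = 0"
    and \<kappa>: "\<kappa> \<in> borel_measurable lborel" "\<And>x. cmod (\<kappa> x) \<le> K" "\<And>x. x \<notin> {s..<s + 1 / \<alpha>} \<Longrightarrow> \<kappa> x = 0"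
  shows "ell2_inner (coeff_map \<alpha> \<beta> g h) (coeff_map \<alpha> \<beta> \<gamma> (\<lambda>x. \<kappa> (x + of_int j / \<alpha>)))
    = of_real (1 / \<alpha>) * (\<Sum>\<^sub>\<infinity>n::int. LINT x|lborel. h x * cnj (\<kappa> x) *
        (\<gamma> (x - \<beta> * of_int n - of_int j / \<alpha>) * cnj (g (x - \<beta> * of_int n))))"
proof -
  let ?E = "windowed_character s (1 / \<alpha>)"
  let ?k = "\<lambda>x. \<kappa> (x + of_int j / \<alpha>)"
  define A where "A n x = h x * cnj (g (x - \<beta> * of_int n))" for n :: int and x
  define B where "B n x = \<kappa> x * cnj (\<gamma> (x - \<beta> * of_int n - of_int j / \<alpha>))" for n :: int and x
  have hL2: "h \<in> L2" and \<kappa>L2: "\<kappa> \<in> L2"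
    using L2_bounded_support[OF h] L2_bounded_support[OF \<kappa>] by blast+
  have kL2: "?k \<in> L2" using L2_shift[OF \<kappa>L2, of "- of_int j / \<alpha>"] by simp
  have AL2: "A n \<in> L2" for n
    unfolding A_def[abs_def] by (intro L2_mult_bounded[OF _ h(1,2)] L2_cnj L2_shift g)
  have BL2: "B n \<in> L2" for n
    unfolding B_def[abs_def]
    using L2_shift[OF L2_shift[OF \<gamma>, of "of_int j / \<alpha>"], of "\<beta> * of_int n"]
    by (intro L2_mult_bounded[OF _ \<kappa>(1,2)] L2_cnj)
  have Bsupp: "B n x = 0" if "x \<notin> {s..<s + 1 / \<alpha>}" for n x
    using \<kappa>(3)[OF that] by (simp add: B_def)
  have gc: "coeff_map \<alpha> \<beta> g h (m, n) = L2_inner (A n) (?E m)" for m n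
    unfolding coeff_map_def L2_inner_def
  proof (intro Bochner_Integration.integral_cong refl)
    show "h x * cnj (WH_system \<alpha> \<beta> g (m, n) x) = A n x * cnj (?E m x)" for x
      using h(3)[of x]
      by (cases "x \<in> {s..<s + 1 / \<alpha>}") (auto simp: A_def WH_system_apply windowed_character_def mult_ac)
  qed
  have \<gamma>c: "coeff_map \<alpha> \<beta> \<gamma> ?k (m, n) = L2_inner (B n) (?E m)" for m n
  proof -
    have "coeff_map \<alpha> \<beta> \<gamma> ?k (m, n)
        = (LINT x|lborel. ?k x * cnj (character (\<alpha> * of_int m) x * \<gamma> (x - \<beta> * of_int n)))"
      by (simp add: coeff_map_def L2_inner_def WH_system_apply)
    also have "\<dots> = (LINT x|lborel. \<kappa> x *
        cnj (character (\<alpha> * of_int m) (x + - of_int j / \<alpha>) * \<gamma> (x - \<beta> * of_int n - of_int j / \<alpha>)))"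
      by (subst lborel_integral_real_affine[where c = 1 and t = "- of_int j / \<alpha>"])
         (simp_all add: algebra_simps)
    also have "\<dots> = L2_inner (B n) (?E m)"
      unfolding L2_inner_def
    proof (intro Bochner_Integration.integral_cong refl)
      fix x
      have "\<alpha> * of_int m * (- of_int j / \<alpha>) = of_int (- m * j)" using \<alpha> by simp
      then have "\<alpha> * of_int m * (- of_int j / \<alpha>) \<in> \<int>" by (metis Ints_of_int)
      then have "character (\<alpha> * of_int m) (x + - of_int j / \<alpha>) = character (\<alpha> * of_int m) x"
        by (rule character_add_integer)
      then show "\<kappa> x * cnj (character (\<alpha> * of_int m) (x + - of_int j / \<alpha>) * \<gamma> (x - \<beta> * of_int n - of_int j / \<alpha>))
          = B n x * cnj (?E m x)"
        using \<kappa>(3)[of x]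
        by (cases "x \<in> {s..<s + 1 / \<alpha>}") (auto simp: B_def windowed_character_def mult_ac)
    qed
    finally show ?thesis .
  qed
  have "coeff_map \<alpha> \<beta> g h \<in> ell2" "coeff_map \<alpha> \<beta> \<gamma> ?k \<in> ell2"
    using bg b\<gamma> hL2 kL2 unfolding bounded_L2_ell2_def by blast+
  then have "ell2_inner (coeff_map \<alpha> \<beta> g h) (coeff_map \<alpha> \<beta> \<gamma> ?k)
      = (\<Sum>\<^sub>\<infinity>n. ell2_inner (\<lambda>m. coeff_map \<alpha> \<beta> g h (m, n)) (\<lambda>m. coeff_map \<alpha> \<beta> \<gamma> ?k (m, n)))"
    by (rule ell2_inner_iterated)
  also have "\<dots> = (\<Sum>\<^sub>\<infinity>n. of_real (1 / \<alpha>) * L2_inner (A n) (B n))"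
    unfolding gc \<gamma>c using \<alpha> AL2 BL2 Bsupp
    by (intro infsum_cong Parseval_windowed_character) auto
  also have "\<dots> = of_real (1 / \<alpha>) * (\<Sum>\<^sub>\<infinity>n. L2_inner (A n) (B n))"
    by (rule infsum_cmult_right')
  finally show ?thesis
    by (simp add: L2_inner_def A_def B_def mult_ac)
qed

definition biorthogonal :: "real \<Rightarrow> real \<Rightarrow> (real \<Rightarrow> complex) \<Rightarrow> (real \<Rightarrow> complex) \<Rightarrow> bool" where
  "biorthogonal \<alpha> \<beta> g \<gamma> \<longleftrightarrow>
    (\<forall>m n :: int.
       L2_inner (modulation (of_int m / \<beta>) (translation (of_int n / \<alpha>) \<gamma>)) g
         = complex_of_real (\<alpha> * \<beta>) * of_bool (m = 0) * of_bool (n = 0))"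

text \<open>
  The periodisation \<open>\<Phi>\<close> of \<open>\<gamma>(x - j/\<alpha>) cnj (g x)\<close> has, by unfolding, the inner products in the
  biorthogonality relation as its (unnormalised) Fourier coefficients. Those are \<open>\<alpha>\<beta>\<close> for
  \<open>m = j = 0\<close> and zero otherwise, exactly as for the constant \<open>\<alpha>\<close> (if \<open>j = 0\<close>) or
  \<open>0\<close> (if \<open>j \<noteq> 0\<close>), so \<open>\<Phi>\<close> equals that constant almost everywhere.
\<close>

lemma biorthogonal_fibre:
  assumes \<beta>: "0 < \<beta>" and g: "g \<in> L2" and \<gamma>: "\<gamma> \<in> L2"
    and bi: "biorthogonal \<alpha> \<beta> g \<gamma>"
    and w: "w \<in> borel_measurable lborel" "\<And>x. cmod (w x) \<le> M" "\<And>x. x \<notin> {s..<s + \<beta>} \<Longrightarrow> w x = 0"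
  shows "(\<Sum>\<^sub>\<infinity>n::int. LINT x|lborel. w x * (\<gamma> (x - \<beta> * of_int n - of_int j / \<alpha>) * cnj (g (x - \<beta> * of_int n))))
    = of_real \<alpha> * of_bool (j = (0::int)) * (LINT x|lborel. w x)"
proof -
  let ?S = "{s..<s + \<beta>}"
  let ?\<delta> = "of_real \<alpha> * of_bool (j = 0) :: complex"
  define G where "G x = \<gamma> (x - of_int j / \<alpha>) * cnj (g x)" for x
  have G: "integrable lborel G"
    unfolding G_def by (intro L2_mult_integrable L2_shift \<gamma> g)
  define \<Phi> where "\<Phi> = periodization s \<beta> G"
  have \<Phi>: "integrable lborel \<Phi>" "\<And>x. x \<notin> ?S \<Longrightarrow> \<Phi> x = 0"
    unfolding \<Phi>_def by (rule integrable_periodization[OF G \<beta>], rule periodization_support)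
  have [measurable]: "\<Phi> \<in> borel_measurable lborel" using \<Phi>(1) by simp
  have ind: "integrable lborel (\<lambda>x. indicator ?S x * character (of_int m / \<beta>) x)" for m :: int
  proof -
    have "integrable lborel (\<lambda>x. of_real (indicat_real ?S x) :: complex)"
      using \<beta> by (intro integrable_of_real integrable_real_indicator) auto
    then show ?thesis
      using integrable_mult_character[of "\<lambda>x. indicator ?S x"] by (simp add: of_real_indicator)
  qed
  have coeff: "(LINT x|lborel. \<Phi> x * character (of_int m / \<beta>) x) = ?\<delta> * (of_real \<beta> * of_bool (m = 0))" for m :: int
  proof -
    let ?\<chi> = "character (of_int m / \<beta>)"
    have "(LINT x|lborel. \<Phi> x * ?\<chi> x) = (LINT x|lborel. (indicator ?S x * ?\<chi> x) * \<Phi> x)"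
      using \<Phi>(2) by (intro Bochner_Integration.integral_cong) (auto simp: indicator_def)
    also have "\<dots> = (\<Sum>\<^sub>\<infinity>n::int. LINT x|lborel. indicator ?S x * ?\<chi> x * G (x - \<beta> * of_int n))"
      unfolding \<Phi>_def
      by (rule periodization_series[symmetric, OF G \<beta>, where M = 1]) (auto simp: indicator_def norm_mult)
    also have "\<dots> = (LINT x|lborel. ?\<chi> x * G x)"
      using \<beta> by (intro integral_periodic_unfold[OF G \<beta>, where M = 1] character_add_integer) auto
    also have "\<dots> = L2_inner (modulation (of_int m / \<beta>) (translation (of_int j / \<alpha>) \<gamma>)) g"
      by (simp add: L2_inner_def modulation_def translation_def G_def character_def mult_ac)
    also have "\<dots> = ?\<delta> * (of_real \<beta> * of_bool (m = 0))"
      using bi by (simp add: biorthogonal_def)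
    finally show ?thesis .
  qed
  have "AE x in lborel. \<Phi> x - ?\<delta> * indicator ?S x = 0"
  proof (rule Fourier_coefficients_zero_imp_AE_zero[OF \<beta>])
    show "integrable lborel (\<lambda>x. \<Phi> x - ?\<delta> * indicator ?S x)"
      using ind[of 0] \<Phi>(1) by (intro Bochner_Integration.integrable_diff integrable_mult_right) simp_all
    show "(LINT x|lborel. (\<Phi> x - ?\<delta> * indicator ?S x) * character (of_int m / \<beta>) x) = 0" for m
    proof -
      let ?\<chi> = "character (of_int m / \<beta>)"
      have "(LINT x|lborel. (\<Phi> x - ?\<delta> * indicator ?S x) * ?\<chi> x)
          = (LINT x|lborel. \<Phi> x * ?\<chi> x - ?\<delta> * (indicator ?S x * ?\<chi> x))"
        by (simp add: algebra_simps)
      also have "\<dots> = (LINT x|lborel. \<Phi> x * ?\<chi> x) - ?\<delta> * (LINT x|lborel. indicator ?S x * ?\<chi> x)"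
        by (subst Bochner_Integration.integral_diff)
          (simp_all only: integral_mult_right_zero integrable_mult_character[OF \<Phi>(1)]
            integrable_mult_right[OF ind])
      also have "\<dots> = 0" by (simp only: coeff character_integral[OF \<beta>]) simp
      finally show ?thesis .
    qed
  qed (use \<Phi>(2) in auto)
  then have AE: "AE x in lborel. \<Phi> x = ?\<delta> * indicator ?S x"
    by eventually_elim (simp only: right_minus_eq)
  have "(\<Sum>\<^sub>\<infinity>n::int. LINT x|lborel. w x * G (x - \<beta> * of_int n)) = (LINT x|lborel. w x * \<Phi> x)"
    unfolding \<Phi>_def by (rule periodization_series[OF G \<beta> w])
  also have "\<dots> = (LINT x|lborel. ?\<delta> * w x)"
  proof (rule integral_cong_AE)
    show "AE x in lborel. w x * \<Phi> x = ?\<delta> * w x"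
      using AE
    proof eventually_elim
      case (elim x)
      then show ?case using w(3)[of x] by (cases "x \<in> ?S") auto
    qed
  qed (use w(1) in measurable)
  also have "\<dots> = ?\<delta> * (LINT x|lborel. w x)" by (rule integral_mult_right_zero)
  finally show ?thesis by (simp only: G_def)
qed

section \<open>Duality and biorthogonality\<close>

lemma cell_cover:
  assumes \<alpha>: "0 < (\<alpha>::real)"
  shows "\<exists>a::int. x \<in> {of_int a / \<alpha>..<of_int a / \<alpha> + 1 / \<alpha>}"
proof (intro exI)
  show "x \<in> {of_int \<lfloor>\<alpha> * x\<rfloor> / \<alpha>..<of_int \<lfloor>\<alpha> * x\<rfloor> / \<alpha> + 1 / \<alpha>}"
  proof -
    have "of_int \<lfloor>\<alpha> * x\<rfloor> \<le> \<alpha> * x" "\<alpha> * x < of_int \<lfloor>\<alpha> * x\<rfloor> + 1" by linarith+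
    then show ?thesis using \<alpha> by (simp add: field_simps)
  qed
qed

lemma cell_disjoint:
  fixes a c :: int
  assumes "0 < (\<alpha>::real)" "x \<in> {of_int a / \<alpha>..<of_int a / \<alpha> + 1 / \<alpha>}"
    "x \<in> {of_int c / \<alpha>..<of_int c / \<alpha> + 1 / \<alpha>}"
  shows "a = c"
proof -
  have "real_of_int a \<le> \<alpha> * x" "\<alpha> * x < real_of_int a + 1" "real_of_int c \<le> \<alpha> * x" "\<alpha> * x < real_of_int c + 1"
    using assms by (simp_all add: pos_divide_le_eq pos_less_divide_eq mult.commute flip: add_divide_distrib)
  then show ?thesis by linarith
qed

text \<open>
  The function \<open>h\<close> is first taken on an intersection of a cell of length \<open>1/\<alpha>\<close>, as needed for the sum over
  \<open>m\<close>, with a cell of length \<open>\<beta>\<close>, as needed for the sum over \<open>n\<close>; \<open>k\<close> lives on any cell of length \<open>1/\<alpha>\<close>.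
  Two such cells differ by a multiple \<open>j/\<alpha>\<close>, and for \<open>j \<noteq> 0\<close> both sides vanish. The two arguments
  are then freed from their cells one after the other: first \<open>k\<close>, by synthesis with \<open>\<gamma>\<close>,
  then \<open>h\<close>, by synthesis with \<open>g\<close>.
\<close>

lemma biorthogonal_imp_reproducing:
  assumes \<alpha>: "0 < \<alpha>" and \<beta>: "0 < \<beta>" and g: "g \<in> L2" and \<gamma>: "\<gamma> \<in> L2"
    and bg: "bounded_L2_ell2 (coeff_map \<alpha> \<beta> g)" and b\<gamma>: "bounded_L2_ell2 (coeff_map \<alpha> \<beta> \<gamma>)"
    and bi: "biorthogonal \<alpha> \<beta> g \<gamma>"
    and h: "h \<in> L2" and k: "k \<in> L2"
  shows "ell2_inner (coeff_map \<alpha> \<beta> \<gamma> k) (coeff_map \<alpha> \<beta> g h) = L2_inner k h"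
proof -
  let ?C = "\<lambda>a::int. {of_int a / \<alpha>..<of_int a / \<alpha> + 1 / \<alpha>}"
  \<comment> \<open>The cells of length \<open>\<beta>\<close>, in the form to which the lemma \<open>cell_cover\<close> applies.\<close>
  let ?D = "\<lambda>b::int. {of_int b / (1 / \<beta>)..<of_int b / (1 / \<beta>) + 1 / (1 / \<beta>)}"
  have ell2: "coeff_map \<alpha> \<beta> g f \<in> ell2" "coeff_map \<alpha> \<beta> \<gamma> f \<in> ell2" if "f \<in> L2" for f
    using bg b\<gamma> that unfolding bounded_L2_ell2_def by blast+
  have cells: "ell2_inner (coeff_map \<alpha> \<beta> g h) (coeff_map \<alpha> \<beta> \<gamma> k) = L2_inner h k"
    if h: "h \<in> borel_measurable lborel" "\<And>x. cmod (h x) \<le> H" "\<And>x. x \<notin> ?C a \<inter> ?D b \<Longrightarrow> h x = 0"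
      and k: "k \<in> borel_measurable lborel" "\<And>x. cmod (k x) \<le> K" "\<And>x. x \<notin> ?C c \<Longrightarrow> k x = 0"
    for h k H K a b c
  proof -
    define j where "j = a - c"
    define \<kappa> where "\<kappa> x = k (x - of_int j / \<alpha>)" for x
    have k_eq: "k = (\<lambda>x. \<kappa> (x + of_int j / \<alpha>))" by (simp add: \<kappa>_def)
    have \<kappa>: "\<kappa> \<in> borel_measurable lborel" "\<And>x. cmod (\<kappa> x) \<le> K"
      using k(1,2) unfolding \<kappa>_def[abs_def] by simp_all
    have \<kappa>supp: "\<kappa> x = 0" if "x \<notin> ?C a" for x
    proof -
      have "x - of_int j / \<alpha> \<notin> ?C c"
        using that by (auto simp: j_def diff_divide_distrib)
      then show ?thesis unfolding \<kappa>_def by (rule k(3))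
    qed
    have hsupp: "h x = 0" if "x \<notin> ?C a" for x using h(3) that by blast
    have "H \<ge> 0" using h(2)[of 0] norm_ge_zero order_trans by blast
    have "ell2_inner (coeff_map \<alpha> \<beta> g h) (coeff_map \<alpha> \<beta> \<gamma> k)
       = of_real (1 / \<alpha>) * (\<Sum>\<^sub>\<infinity>n::int. LINT x|lborel. h x * cnj (\<kappa> x) *
        (\<gamma> (x - \<beta> * of_int n - of_int j / \<alpha>) * cnj (g (x - \<beta> * of_int n))))"
      unfolding k_eq by (rule coeff_map_cell_pairing[OF \<alpha> g \<gamma> bg b\<gamma> h(1,2) hsupp \<kappa> \<kappa>supp])
    also have "\<dots> = of_real (1 / \<alpha>) * (of_real \<alpha> * of_bool (j = 0) * (LINT x|lborel. h x * cnj (\<kappa> x)))"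
    proof (intro arg_cong2[of _ _ _ _ "(*)"] refl biorthogonal_fibre[OF \<beta> g \<gamma> bi])
      have [measurable]: "h \<in> borel_measurable lborel" "\<kappa> \<in> borel_measurable lborel" by fact+
      show "(\<lambda>x. h x * cnj (\<kappa> x)) \<in> borel_measurable lborel" by measurable
      show "cmod (h x * cnj (\<kappa> x)) \<le> H * K" for x
        unfolding norm_mult complex_mod_cnj by (intro mult_mono h \<kappa> \<open>H \<ge> 0\<close>) auto
      show "h x * cnj (\<kappa> x) = 0" if "x \<notin> {of_int b * \<beta>..<of_int b * \<beta> + \<beta>}" for x
        using h(3)[of x] that by simp
    qed
    also have "\<dots> = of_bool (j = 0) * (LINT x|lborel. h x * cnj (\<kappa> x))"
      using \<alpha> by simp
    also have "\<dots> = L2_inner h k"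
    proof (cases "j = 0")
      case True
      then show ?thesis by (simp add: L2_inner_def \<kappa>_def)
    next
      case False
      have "h x * cnj (k x) = 0" for x
        using cell_disjoint[OF \<alpha>, of x a c] h(3)[of x] k(3)[of x] False by (auto simp: j_def)
      then have "L2_inner h k = 0" unfolding L2_inner_def by (simp only: Bochner_Integration.integral_zero)
      then show ?thesis using False by simp
    qed
    finally show ?thesis .
  qed
  have cellh: "ell2_inner (coeff_map \<alpha> \<beta> \<gamma> k) (coeff_map \<alpha> \<beta> g h) = L2_inner k h"
    if h: "h \<in> borel_measurable lborel" "\<And>x. cmod (h x) \<le> H" "\<And>x. x \<notin> ?C a \<inter> ?D b \<Longrightarrow> h x = 0" "h \<in> L2"
      and k: "k \<in> L2" for h k H a b
  proof -
    obtain u where u: "u \<in> L2"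
      "\<forall>k\<in>L2. L2_inner k u = ell2_inner (coeff_map \<alpha> \<beta> \<gamma> k) (coeff_map \<alpha> \<beta> g h)"
      using coeff_map_synthesis[OF \<gamma> b\<gamma> ell2(1)[OF h(4)]] by (elim exE conjE)
    have "AE x in lborel. u x = h x"
    proof (rule L2_eq_AE_on_cells[OF u(1) h(4), where C = ?C])
      show "\<exists>i. x \<in> ?C i" for x by (rule cell_cover[OF \<alpha>])
      fix i k M
      assume k: "k \<in> borel_measurable lborel" "\<And>x. cmod (k x) \<le> M" "\<And>x. x \<notin> ?C i \<Longrightarrow> k x = 0" "k \<in> L2"
      have "L2_inner k u = cnj (ell2_inner (coeff_map \<alpha> \<beta> g h) (coeff_map \<alpha> \<beta> \<gamma> k))"
        unfolding bspec[OF u(2) k(4)] by (rule ell2_inner_commute)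
      also have "\<dots> = cnj (L2_inner h k)"
        by (rule arg_cong[of _ _ cnj], rule cells[OF h(1-3) k(1-3)])
      also have "\<dots> = L2_inner k h" by (rule L2_inner_commute[symmetric])
      finally show "L2_inner k u = L2_inner k h" .
    qed simp
    then show ?thesis
      using u k h(4) by (simp add: L2_eq_AE_iff_inner)
  qed
  obtain v where v: "v \<in> L2"
    "\<forall>h\<in>L2. L2_inner h v = ell2_inner (coeff_map \<alpha> \<beta> g h) (coeff_map \<alpha> \<beta> \<gamma> k)"
    using coeff_map_synthesis[OF g bg ell2(2)[OF k]] by (elim exE conjE)
  have "AE x in lborel. v x = k x"
  proof (rule L2_eq_AE_on_cells[OF v(1) k, where C = "\<lambda>(a, b). ?C a \<inter> ?D b"])
    show "\<exists>i. x \<in> (case i of (a, b) \<Rightarrow> ?C a \<inter> ?D b)" for x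
      using cell_cover[OF \<alpha>, of x] cell_cover[of "1 / \<beta>" x] \<beta> by fastforce
    fix i h M
    assume h: "h \<in> borel_measurable lborel" "\<And>x. cmod (h x) \<le> M"
      "\<And>x. x \<notin> (case i of (a, b) \<Rightarrow> ?C a \<inter> ?D b) \<Longrightarrow> h x = 0" "h \<in> L2"
    obtain a b where i: "i = (a, b)" by (cases i)
    have supp: "h x = 0" if "x \<notin> ?C a \<inter> ?D b" for x
      using h(3)[of x] that unfolding i by simp
    have "L2_inner h v = cnj (ell2_inner (coeff_map \<alpha> \<beta> \<gamma> k) (coeff_map \<alpha> \<beta> g h))"
      unfolding bspec[OF v(2) h(4)] by (rule ell2_inner_commute)
    also have "\<dots> = cnj (L2_inner k h)"
      by (rule arg_cong[of _ _ cnj], rule cellh[OF h(1,2) supp h(4) k])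
    also have "\<dots> = L2_inner h k" by (rule L2_inner_commute[symmetric])
    finally show "L2_inner h v = L2_inner h k" .
  qed auto
  then have "ell2_inner (coeff_map \<alpha> \<beta> g h) (coeff_map \<alpha> \<beta> \<gamma> k) = L2_inner h k"
    using v k h by (simp add: L2_eq_AE_iff_inner)
  then show ?thesis
    by (metis ell2_inner_commute L2_inner_commute)
qed

text \<open>
  Test functions: the character of frequency \<open>m/\<beta>\<close> on \<open>[0, \<beta>)\<close> for \<open>h\<close>, and the indicator of that interval shifted
  by \<open>- j/\<alpha>\<close> for \<open>k\<close>. As \<open>\<beta> \<le> 1/\<alpha>\<close>, the interval fits into one cell and its shifts
  by nonzero multiples of \<open>1/\<alpha>\<close> are disjoint from it. So \<open>\<langle>h, k\<rangle>\<close> is \<open>\<beta>\<close> for \<open>m = j = 0\<close> and zero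
  otherwise, whereas the double sum unfolds to \<open>1/\<alpha>\<close> times the inner product in question.
\<close>

lemma reproducing_imp_biorthogonal:
  assumes \<alpha>: "0 < \<alpha>" and \<beta>: "0 < \<beta>" and \<alpha>\<beta>: "\<alpha> * \<beta> \<le> 1" and g: "g \<in> L2" and \<gamma>: "\<gamma> \<in> L2"
    and bg: "bounded_L2_ell2 (coeff_map \<alpha> \<beta> g)" and b\<gamma>: "bounded_L2_ell2 (coeff_map \<alpha> \<beta> \<gamma>)"
    and rep: "\<And>h k. h \<in> L2 \<Longrightarrow> k \<in> L2 \<Longrightarrow>
      ell2_inner (coeff_map \<alpha> \<beta> \<gamma> k) (coeff_map \<alpha> \<beta> g h) = L2_inner k h"
  shows "biorthogonal \<alpha> \<beta> g \<gamma>"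
  unfolding biorthogonal_def
proof (intro allI)
  fix m j :: int
  let ?\<chi> = "character (of_int m / \<beta>)" and ?S = "{0..<0 + \<beta>}"
  define h where "h x = indicator ?S x * ?\<chi> x" for x
  define \<kappa> :: "real \<Rightarrow> complex" where "\<kappa> x = indicator ?S x" for x
  define k where "k x = \<kappa> (x + of_int j / \<alpha>)" for x
  define G where "G x = \<gamma> (x - of_int j / \<alpha>) * cnj (g x)" for x
  have \<beta>_le: "\<beta> \<le> 1 / \<alpha>" using \<alpha> \<alpha>\<beta> by (simp add: field_simps)
  have h: "h \<in> borel_measurable lborel" "\<And>x. cmod (h x) \<le> 1" "\<And>x. x \<notin> {0..<0 + 1 / \<alpha>} \<Longrightarrow> h x = 0"
    and \<kappa>: "\<kappa> \<in> borel_measurable lborel" "\<And>x. cmod (\<kappa> x) \<le> 1" "\<And>x. x \<notin> {0..<0 + 1 / \<alpha>} \<Longrightarrow> \<kappa> x = 0"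
    using \<beta>_le unfolding h_def[abs_def] \<kappa>_def[abs_def] by (auto simp: indicator_def norm_mult)
  have hL2: "h \<in> L2" and "\<kappa> \<in> L2"
    using L2_bounded_support[OF h] L2_bounded_support[OF \<kappa>] by blast+
  then have kL2: "k \<in> L2"
    unfolding k_def[abs_def] using L2_shift[of \<kappa> "- of_int j / \<alpha>"] by simp
  have G: "integrable lborel G"
    unfolding G_def by (intro L2_mult_integrable L2_shift \<gamma> g)
  have per: "(\<Sum>\<^sub>\<infinity>n::int. LINT x|lborel. indicator ?S x * ?\<chi> x * G (x - \<beta> * of_int n)) = (LINT x|lborel. ?\<chi> x * G x)"
    using \<beta> by (intro integral_periodic_unfold[OF G \<beta>, where M = 1] character_add_integer) auto
  have integrand: "h x * cnj (\<kappa> x) * (\<gamma> (x - \<beta> * of_int n - of_int j / \<alpha>) * cnj (g (x - \<beta> * of_int n)))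
      = indicator ?S x * ?\<chi> x * G (x - \<beta> * of_int n)" for x and n :: int
    by (simp add: h_def \<kappa>_def G_def indicator_def)
  have "L2_inner h k = cnj (L2_inner k h)" by (rule L2_inner_commute)
  also have "\<dots> = cnj (ell2_inner (coeff_map \<alpha> \<beta> \<gamma> k) (coeff_map \<alpha> \<beta> g h))"
    by (simp only: rep[OF hL2 kL2])
  also have "\<dots> = ell2_inner (coeff_map \<alpha> \<beta> g h) (coeff_map \<alpha> \<beta> \<gamma> k)"
    by (rule ell2_inner_commute[symmetric])
  also have "\<dots> = of_real (1 / \<alpha>) * (\<Sum>\<^sub>\<infinity>n::int. LINT x|lborel. h x * cnj (\<kappa> x) *
        (\<gamma> (x - \<beta> * of_int n - of_int j / \<alpha>) * cnj (g (x - \<beta> * of_int n))))"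
    unfolding k_def[abs_def] by (rule coeff_map_cell_pairing[OF \<alpha> g \<gamma> bg b\<gamma> h \<kappa>])
  also have "\<dots> = of_real (1 / \<alpha>) * (\<Sum>\<^sub>\<infinity>n::int. LINT x|lborel. indicator ?S x * ?\<chi> x * G (x - \<beta> * of_int n))"
    by (simp only: integrand)
  also have "\<dots> = of_real (1 / \<alpha>) * L2_inner (modulation (of_int m / \<beta>) (translation (of_int j / \<alpha>) \<gamma>)) g"
    unfolding per by (simp add: L2_inner_def modulation_def translation_def G_def character_def mult_ac)
  finally have "L2_inner (modulation (of_int m / \<beta>) (translation (of_int j / \<alpha>) \<gamma>)) g = of_real \<alpha> * L2_inner h k"
    using \<alpha> by simp
  also have "L2_inner h k = of_bool (j = 0) * (LINT x|lborel. indicator ?S x * ?\<chi> x)"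
  proof (cases "j = 0")
    case True
    then show ?thesis
      unfolding L2_inner_def h_def k_def \<kappa>_def
      by simp (intro Bochner_Integration.integral_cong, auto simp: indicator_def)
  next
    case False
    have "h x * cnj (k x) = 0" for x
    proof (rule ccontr)
      assume "h x * cnj (k x) \<noteq> 0"
      then have "x \<in> ?S" "x + of_int j / \<alpha> \<in> ?S"
        by (auto simp: h_def k_def \<kappa>_def indicator_def split: if_splits)
      then have "\<bar>of_int j / \<alpha>\<bar> < 1 / \<alpha>" using \<beta>_le by auto
      then have "\<bar>real_of_int j\<bar> < 1" using \<alpha> by (simp add: abs_divide field_simps)
      then show False using False by linarith
    qed
    then have "L2_inner h k = 0" unfolding L2_inner_def by (simp only: Bochner_Integration.integral_zero)
      then show ?thesis using False by simp
  qed
  also have "(LINT x|lborel. indicator ?S x * ?\<chi> x) = of_real \<beta> * of_bool (m = 0)"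
    by (rule character_integral[OF \<beta>])
  finally show "L2_inner (modulation (of_int m / \<beta>) (translation (of_int j / \<alpha>) \<gamma>)) g
      = complex_of_real (\<alpha> * \<beta>) * of_bool (m = 0) * of_bool (j = 0)"
    by simp
qed

text \<open>
  The lower bound: \<open>\<parallel>h\<parallel>\<^sup>2\<close> is the pairing of the two coefficient families, so it is at most
  the norm of the \<open>\<gamma>\<close>-coefficients times \<open>A \<parallel>h\<parallel>\<close>, where \<open>A\<close> bounds the \<open>g\<close>-coefficients.
\<close>

lemma reproducing_imp_frame:
  assumes \<gamma>: "\<gamma> \<in> L2"
    and bg: "bounded_L2_ell2 (coeff_map \<alpha> \<beta> g)" and b\<gamma>: "bounded_L2_ell2 (coeff_map \<alpha> \<beta> \<gamma>)"
    and rep: "\<And>h. h \<in> L2 \<Longrightarrow> ell2_inner (coeff_map \<alpha> \<beta> \<gamma> h) (coeff_map \<alpha> \<beta> g h) = L2_inner h h"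
  shows "generates_WH_frame \<alpha> \<beta> \<gamma>"
proof -
  obtain A where A: "0 < A" "\<And>h. h \<in> L2 \<Longrightarrow> coeff_map \<alpha> \<beta> g h \<in> ell2"
      "\<And>h. h \<in> L2 \<Longrightarrow> ell2_norm (coeff_map \<alpha> \<beta> g h) \<le> A * L2_norm h"
    using bounded_L2_ell2_obtain[OF bg] by blast
  obtain B where B: "0 < B" "\<And>h. h \<in> L2 \<Longrightarrow> coeff_map \<alpha> \<beta> \<gamma> h \<in> ell2"
      "\<And>h. h \<in> L2 \<Longrightarrow> ell2_norm (coeff_map \<alpha> \<beta> \<gamma> h) \<le> B * L2_norm h"
    using bounded_L2_ell2_obtain[OF b\<gamma>] by blast
  show ?thesis
    unfolding generates_WH_frame_def L2_frame_def
  proof (intro conjI allI, goal_cases)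
    case (1 p)
    show ?case by (rule WH_system_L2[OF \<gamma>])
  next
    case 2
    show ?case
    proof (rule exI[of _ "(1 / A)\<^sup>2"], rule exI[of _ "B\<^sup>2"], intro conjI ballI)
      show "0 < (1 / A)\<^sup>2" using A(1) by simp
      fix h assume h: "h \<in> L2"
      let ?c = "coeff_map \<alpha> \<beta> \<gamma> h"
      have c: "(ell2_norm ?c)\<^sup>2 = (\<Sum>\<^sub>\<infinity>p. (cmod (L2_inner h (WH_system \<alpha> \<beta> \<gamma> p)))\<^sup>2)"
        unfolding ell2_norm_squared coeff_map_def ..
      show "(\<lambda>p. (cmod (L2_inner h (WH_system \<alpha> \<beta> \<gamma> p)))\<^sup>2) summable_on UNIV"
        using B(2)[OF h] by (simp add: ell2_def coeff_map_def)
      have "(ell2_norm ?c)\<^sup>2 \<le> (B * L2_norm h)\<^sup>2"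
        by (intro power_mono B h ell2_norm_nonneg)
      then show "(\<Sum>\<^sub>\<infinity>p. (cmod (L2_inner h (WH_system \<alpha> \<beta> \<gamma> p)))\<^sup>2) \<le> B\<^sup>2 * (L2_norm h)\<^sup>2"
        unfolding c by (simp add: power_mult_distrib)
      have "L2_norm h * L2_norm h = cmod (L2_inner h h)"
        by (simp add: L2_inner_self power2_eq_square L2_norm_nonneg norm_mult)
      also have "\<dots> \<le> ell2_norm ?c * ell2_norm (coeff_map \<alpha> \<beta> g h)"
        unfolding rep[OF h, symmetric] by (intro ell2_Cauchy_Schwarz A B h)
      also have "\<dots> \<le> ell2_norm ?c * (A * L2_norm h)"
        by (intro mult_left_mono A h ell2_norm_nonneg)
      finally have "L2_norm h * L2_norm h \<le> (A * ell2_norm ?c) * L2_norm h" by (simp add: mult_ac)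
      then have "L2_norm h \<le> A * ell2_norm ?c"
        using L2_norm_nonneg[of h] A(1) ell2_norm_nonneg[of ?c]
        by (cases "L2_norm h = 0") auto
      then have "1 / A * L2_norm h \<le> ell2_norm ?c"
        using A(1) by (simp add: field_simps)
      then have "(1 / A * L2_norm h)\<^sup>2 \<le> (ell2_norm ?c)\<^sup>2"
        using A(1) L2_norm_nonneg[of h] by (intro power_mono) auto
      then show "(1 / A)\<^sup>2 * (L2_norm h)\<^sup>2 \<le> (\<Sum>\<^sub>\<infinity>p. (cmod (L2_inner h (WH_system \<alpha> \<beta> \<gamma> p)))\<^sup>2)"
        unfolding c by (simp only: power_mult_distrib)
    qed
  qed
qed

theorem corollary4p3:
  fixes \<alpha> \<beta> :: real and g \<gamma> :: "real \<Rightarrow> complex"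
  assumes "\<alpha> > 0" and "\<beta> > 0" and "\<alpha> * \<beta> \<le> 1"
    and "g \<in> L2" and "\<gamma> \<in> L2"
    and "bounded_L2_ell2 (coeff_map \<alpha> \<beta> g)"
    and "bounded_L2_ell2 (coeff_map \<alpha> \<beta> \<gamma>)"
  shows "dual_window \<alpha> \<beta> g \<gamma> \<longleftrightarrow>
    (\<forall>m n :: int.
       L2_inner (modulation (of_int m / \<beta>) (translation (of_int n / \<alpha>) \<gamma>)) g
         = complex_of_real (\<alpha> * \<beta>) * of_bool (m = 0) * of_bool (n = 0))"
proof -
  have ell2: "coeff_map \<alpha> \<beta> g h \<in> ell2" if "h \<in> L2" for h
    using assms(6) that unfolding bounded_L2_ell2_def by blast
  have adj: "(\<forall>h\<in>L2. AE x in lborel. L2_adjoint (coeff_map \<alpha> \<beta> \<gamma>) (coeff_map \<alpha> \<beta> g h) x = h x)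
      \<longleftrightarrow> (\<forall>h\<in>L2. \<forall>k\<in>L2. ell2_inner (coeff_map \<alpha> \<beta> \<gamma> k) (coeff_map \<alpha> \<beta> g h) = L2_inner k h)"
    by (intro ball_cong refl L2_adjoint_AE_eq_iff assms ell2)
  show ?thesis
    unfolding dual_window_def adj biorthogonal_def[symmetric]
  proof (intro iffI conjI)
    assume "\<gamma> \<in> L2 \<and> generates_WH_frame \<alpha> \<beta> \<gamma> \<and>
      (\<forall>h\<in>L2. \<forall>k\<in>L2. ell2_inner (coeff_map \<alpha> \<beta> \<gamma> k) (coeff_map \<alpha> \<beta> g h) = L2_inner k h)"
    then show "biorthogonal \<alpha> \<beta> g \<gamma>"
      by (intro reproducing_imp_biorthogonal assms) blast
  next
    assume bi: "biorthogonal \<alpha> \<beta> g \<gamma>"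
    show rep: "\<forall>h\<in>L2. \<forall>k\<in>L2. ell2_inner (coeff_map \<alpha> \<beta> \<gamma> k) (coeff_map \<alpha> \<beta> g h) = L2_inner k h"
      using biorthogonal_imp_reproducing[OF assms(1,2,4-7) bi] by blast
    show "generates_WH_frame \<alpha> \<beta> \<gamma>"
      using rep by (intro reproducing_imp_frame[OF assms(5-7)]) blast
  qed (rule assms)
qed

end
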